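(* Let $\Lambda=\{1,\ldots,N_s\}$ with $N_s$ even and periodic boundary conditions, $t>0$, $t'>0$, and $$H=-t\sum_{x=1}^{N_s}\sum_{\sigma}(c^\dagger_{x,\sigma}c_{x+1,\sigma}+c^\dagger_{x+1,\sigma}c_{x,\sigma})+t'\sum_{j=1}^{N_s/2}\sum_{\sigma}(c^\dagger_{2j,\sigma}c_{2j+2,\sigma}+c^\dagger_{2j+2,\sigma}c_{2j,\sigma})+U\sum_{x}n_{x,\uparrow}n_{x,\downarrow}+V\Big\{\sum_{x=1}^{N_s}n_xn_{x+1}-(2N_e-N_s)\Big\}.$$ Let the electron number $N_e$ be odd with $N_s>N_e>N_s/2$, and take the limits $U\to\infty$, $V\to\infty$. Then the ground states have total spin $S_{\rm tot}=S_{\max}=N_e/2$ and are nondegenerate apart from the trivial $(2S_{\max}+1)$-fold degeneracy.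
   Context: $c_{x,\sigma}$ are fermion annihilation operators ($x\in\Lambda$, $\sigma\in\{\uparrow,\downarrow\}$) with canonical anticommutation relations and vacuum $\Phi_{\rm vac}$; $\mathcal H_{N_e}$ is the span of $c^\dagger_{x_1,\sigma_1}\cdots c^\dagger_{x_{N_e},\sigma_{N_e}}\Phi_{\rm vac}$; $n_{x,\sigma}=c^\dagger_{x,\sigma}c_{x,\sigma}$, $n_x=n_{x,\uparrow}+n_{x,\downarrow}$. The limit $U,V\to\infty$ means: let $P$ be the orthogonal projection onto the span of states with no doubly occupied site and with $\sum_x n_xn_{x+1}=2N_e-N_s$ (its minimal possible value, equivalently no two neighboring empty sites); one studies $PH_{\rm hop}P$ on $P\mathcal H_{N_e}$, where $H_{\rm hop}$ consists of the $t$ and $t'$ terms of $H$; ground states are its lowest-eigenvalue eigenvectors. Total spin operators $S^{(\alpha)}_{\rm tot}=\frac12\sum_x\sum_{\sigma,\tau}c^\dagger_{x,\sigma}(p^{(\alpha)})_{\sigma,\tau}c_{x,\tau}$ (Pauli matrices); total spin $S_{\rm tot}$ means $\sum_\alpha(S^{(\alpha)}_{\rm tot})^2=S_{\rm tot}(S_{\rm tot}+1)$. "Nondegenerate apart from the trivial $(2S_{\max}+1)$-fold degeneracy" means the ground-state eigenspace has dimension exactly $2S_{\max}+1$ and all ground states have $S_{\rm tot}=S_{\max}$. *)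

theory Defs
  imports Complex_Main "HOL-Library.Function_Algebras"
begin

text \<open>Fock space over the modes (x, sigma), x a site, sigma :: bool (True = up,
False = down).  A state is a complex function on sets of occupied modes
(occupation-number basis, Jordan-Wigner sign convention).\<close>

type_synonym mode = "nat \<times> bool"
type_synonym fock = "mode set \<Rightarrow> complex"

definition mode_idx :: "mode \<Rightarrow> nat" where
  "mode_idx m = 2 * fst m + (if snd m then 0 else 1)"

definition jw_sign :: "mode \<Rightarrow> mode set \<Rightarrow> complex" where
  "jw_sign m S = (-1) ^ card {m' \<in> S. mode_idx m' < mode_idx m}"

definition ann :: "mode \<Rightarrow> fock \<Rightarrow> fock" where
  "ann m \<psi> = (\<lambda>S. if m \<notin> S then jw_sign m S * \<psi> (insert m S) else 0)"

definition cre :: "mode \<Rightarrow> fock \<Rightarrow> fock" where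
  "cre m \<psi> = (\<lambda>S. if m \<in> S then jw_sign m S * \<psi> (S - {m}) else 0)"

definition vac :: fock where
  "vac = (\<lambda>S. if S = {} then 1 else 0)"

definition cscale :: "complex \<Rightarrow> fock \<Rightarrow> fock" where
  "cscale a \<psi> = (\<lambda>S. a * \<psi> S)"

definition wrap :: "nat \<Rightarrow> nat \<Rightarrow> nat" where
  "wrap Ns y = (y - 1) mod Ns + 1"

definition H_hop :: "nat \<Rightarrow> real \<Rightarrow> real \<Rightarrow> fock \<Rightarrow> fock" where
  "H_hop Ns t t' \<psi> =
     (\<lambda>S. - complex_of_real t *
            (\<Sum>x\<in>{1..Ns}. \<Sum>\<sigma>\<in>UNIV.
               cre (x,\<sigma>) (ann (wrap Ns (x+1),\<sigma>) \<psi>) S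
             + cre (wrap Ns (x+1),\<sigma>) (ann (x,\<sigma>) \<psi>) S)
        + complex_of_real t' *
            (\<Sum>j\<in>{1..Ns div 2}. \<Sum>\<sigma>\<in>UNIV.
               cre (2*j,\<sigma>) (ann (wrap Ns (2*j+2),\<sigma>) \<psi>) S
             + cre (wrap Ns (2*j+2),\<sigma>) (ann (2*j,\<sigma>) \<psi>) S))"

definition H_N :: "nat \<Rightarrow> nat \<Rightarrow> fock set" where
  "H_N Ns Ne = module.span cscale
     {foldr cre ms vac | ms. length ms = Ne \<and> (\<forall>m\<in>set ms. fst m \<in> {1..Ns})}"

definition occ :: "mode set \<Rightarrow> nat \<Rightarrow> nat" where
  "occ S x = card {\<sigma>. (x,\<sigma>) \<in> S}"

definition allowed :: "nat \<Rightarrow> nat \<Rightarrow> mode set \<Rightarrow> bool" where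
  "allowed Ns Ne S \<longleftrightarrow> (\<forall>x\<in>{1..Ns}. occ S x \<le> 1) \<and>
     int (\<Sum>x\<in>{1..Ns}. occ S x * occ S (wrap Ns (x+1))) = 2 * int Ne - int Ns"

definition proj :: "nat \<Rightarrow> nat \<Rightarrow> fock \<Rightarrow> fock" where
  "proj Ns Ne \<psi> = (\<lambda>S. if allowed Ns Ne S then \<psi> S else 0)"

definition eff_H :: "nat \<Rightarrow> nat \<Rightarrow> real \<Rightarrow> real \<Rightarrow> fock \<Rightarrow> fock" where
  "eff_H Ns Ne t t' \<psi> = proj Ns Ne (H_hop Ns t t' (proj Ns Ne \<psi>))"

definition restricted_space :: "nat \<Rightarrow> nat \<Rightarrow> fock set" where
  "restricted_space Ns Ne = proj Ns Ne ` H_N Ns Ne"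

definition is_eigenvalue :: "nat \<Rightarrow> nat \<Rightarrow> real \<Rightarrow> real \<Rightarrow> complex \<Rightarrow> bool" where
  "is_eigenvalue Ns Ne t t' E \<longleftrightarrow>
     (\<exists>\<psi>\<in>restricted_space Ns Ne. \<psi> \<noteq> 0 \<and> eff_H Ns Ne t t' \<psi> = cscale E \<psi>)"

definition eigenspace :: "nat \<Rightarrow> nat \<Rightarrow> real \<Rightarrow> real \<Rightarrow> complex \<Rightarrow> fock set" where
  "eigenspace Ns Ne t t' E =
     {\<psi>\<in>restricted_space Ns Ne. eff_H Ns Ne t t' \<psi> = cscale E \<psi>}"

text \<open>Pauli matrices p^(1), p^(2), p^(3); index True = up (first row/column)\<close>
definition pauli :: "nat \<Rightarrow> bool \<Rightarrow> bool \<Rightarrow> complex" where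
  "pauli \<alpha> \<sigma> \<tau> =
     (if \<alpha> = 1 then (if \<sigma> \<noteq> \<tau> then 1 else 0)
      else if \<alpha> = 2 then (if \<sigma> = \<tau> then 0 else if \<sigma> then - \<i> else \<i>)
      else (if \<sigma> = \<tau> then (if \<sigma> then 1 else -1) else 0))"

definition S_tot :: "nat \<Rightarrow> nat \<Rightarrow> fock \<Rightarrow> fock" where
  "S_tot Ns \<alpha> \<psi> = (\<lambda>S. (1/2) *
     (\<Sum>x\<in>{1..Ns}. \<Sum>\<sigma>\<in>UNIV. \<Sum>\<tau>\<in>UNIV. pauli \<alpha> \<sigma> \<tau> * cre (x,\<sigma>) (ann (x,\<tau>) \<psi>) S))"

definition S_tot_sq :: "nat \<Rightarrow> fock \<Rightarrow> fock" where
  "S_tot_sq Ns \<psi> = (\<lambda>S. \<Sum>\<alpha>\<in>{1,2,3}. S_tot Ns \<alpha> (S_tot Ns \<alpha> \<psi>) S)"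

end

theory Submission
  imports Defs "HOL-Analysis.Function_Topology" "HOL-Library.Multiset"
begin

text \<open>
In the occupation basis ordered by sites, every matrix element of the effective Hamiltonian is
nonpositive: a nearest-neighbour hop passes no electron, or Ne - 1 (an even number) across the
boundary, while a next-nearest-neighbour hop passes one electron, or Ne - 2 across the boundary, and
this sign compensates the sign of t'. The amplitudes depend only on the occupied sites.
If f is the positive Perron vector of the spinless problem with eigenvalue -E0, then
f(sites) g(number of up spins) is an eigenvector for E0 for every g. It is strictly positive for g = 1,
hence E0 is the lowest eigenvalue, and a ground state divided by f is constant on the classes of
configurations connected by hops. Two configurations are connected as soon as they have the same
number of up spins, because nearest-neighbour hops move the holes everywhere and a
next-nearest-neighbour hop exchanges two adjacent spins. So the ground states are exactly the
f(sites) g(number of up spins), which form a space of dimension Ne + 1 and have maximal spin.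
\<close>

section \<open>Perron--Frobenius for symmetric nonnegative matrices\<close>

text \<open>Hops conserve the number of up spins, so the matrix on spin configurations is not
  irreducible. Perron's theorem is applied only to the spinless site matrix, and
  \<open>perron_gap_identity\<close> carries the result over: the distance of an eigenvalue from the
  Perron value is a weighted sum of squares of differences of psi/F. Its sign bounds the spectrum;
  its vanishing makes psi/F constant along hops. The main obstacle is connectivity.
  Nearest-neighbour hops keep the cyclic order of the electrons, while a t' hop permutes them but
  starts only from even sites and must leave the holes isolated. On the universal cover the cyclic
  order is built in: configurations become increasing integer functions, and a nearest-neighbour hop
  raises or lowers one of them by 1. The electrons can then be driven into a standard position that
  admits the t' hop, and back again. Evenness of \<open>Ns\<close> enters twice: the parity of an
  integer coordinate descends to the ring, and \<open>Ns < 2 * Ne\<close> sharpens to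
  \<open>Ns + 2 \<le> 2 * Ne\<close>, which makes room for the standard position.\<close>

text \<open>Maximise the quadratic form of \<open>W\<close> over nonnegative unit vectors. Passing
  to absolute values shows that this is the maximum over all unit vectors, so the maximiser is an
  eigenvector; irreducibility makes it strictly positive.\<close>

lemma perron_vector_exists:
  fixes W :: "'a \<Rightarrow> 'a \<Rightarrow> real"
  assumes fin: "finite C" and ne: "C \<noteq> {}"
    and nonneg: "\<And>i j. i \<in> C \<Longrightarrow> j \<in> C \<Longrightarrow> 0 \<le> W i j"
    and sym: "\<And>i j. i \<in> C \<Longrightarrow> j \<in> C \<Longrightarrow> W i j = W j i"
    and irr: "\<And>i j. i \<in> C \<Longrightarrow> j \<in> C \<Longrightarrow> (\<lambda>i j. i \<in> C \<and> j \<in> C \<and> 0 < W i j)\<^sup>*\<^sup>* i j"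
  shows "\<exists>l f. (\<forall>i\<in>C. 0 < f i) \<and> (\<forall>i\<in>C. (\<Sum>j\<in>C. W i j * f j) = l * f i)"
proof -
  define q where "q x = (\<Sum>i\<in>C. \<Sum>j\<in>C. W i j * x i * x j)" for x :: "'a \<Rightarrow> real"
  define n where "n x = (\<Sum>i\<in>C. (x i)\<^sup>2)" for x :: "'a \<Rightarrow> real"
  \<comment> \<open>Vectors are functions on the whole type; pinning them to 0 outside
    \<open>C\<close> makes the set compact in the product topology.\<close>
  define K0 where "K0 = Pi\<^sub>E UNIV (\<lambda>i. if i \<in> C then {0..1::real} else {0})"
  define K where "K = K0 \<inter> {x. n x = 1}"
  have cn: "continuous_on UNIV n" unfolding n_def
    by (intro continuous_intros continuous_on_product_coordinates)
  have cq: "continuous_on UNIV q" unfolding q_def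
    by (intro continuous_intros continuous_on_product_coordinates)
  have "compact K0"
    using compactin_PiE[of "\<lambda>_. euclidean" UNIV "\<lambda>i. if i \<in> C then {0..1::real} else {0}"]
    by (simp add: K0_def euclidean_product_topology compactin_euclidean_iff flip: PiE_UNIV_domain)
  moreover have "closed {x. n x = 1}"
    using closed_Collect_eq[OF cn, of "\<lambda>_. 1"] by simp
  ultimately have compK: "compact K" unfolding K_def by (rule compact_Int_closed)
  have normalized: "(\<lambda>i. if i \<in> C then \<bar>y i\<bar> / sqrt (n y) else 0) \<in> K" if "n y > 0" for y
  proof -
    have le: "\<bar>y i\<bar> / sqrt (n y) \<le> 1" if "i \<in> C" for i
    proof -
      have "(y i)\<^sup>2 \<le> n y" unfolding n_def using that fin by (intro member_le_sum) auto
      then have "\<bar>y i\<bar> \<le> sqrt (n y)" using real_le_rsqrt by fastforce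
      then show ?thesis using \<open>n y > 0\<close> by simp
    qed
    have "(\<Sum>i\<in>C. (\<bar>y i\<bar> / sqrt (n y))\<^sup>2) = (\<Sum>i\<in>C. (y i)\<^sup>2) / n y"
      using \<open>n y > 0\<close> by (simp add: power_divide sum_divide_distrib)
    then have "n (\<lambda>i. if i \<in> C then \<bar>y i\<bar> / sqrt (n y) else 0) = 1"
      using \<open>n y > 0\<close> by (simp add: n_def)
    then show ?thesis using le \<open>n y > 0\<close> by (auto simp: K_def K0_def PiE_UNIV_domain)
  qed
  obtain c where c: "c \<in> C" using ne by auto
  have "n (\<lambda>_. 1) > 0" using c fin by (simp add: n_def card_gt_0_iff ne)
  with normalized have "K \<noteq> {}" by blast
  then obtain x where x: "x \<in> K" and max: "\<And>y. y \<in> K \<Longrightarrow> q y \<le> q x"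
    using continuous_attains_sup[OF compK _ continuous_on_subset[OF cq]] by blast
  have x0: "0 \<le> x i" if "i \<in> C" for i
    using x that by (auto simp: K_def K0_def PiE_def Pi_def split: if_splits dest: spec[of _ i])
  have nx: "n x = 1" using x by (simp add: K_def)
  have rayleigh: "q y \<le> q x * n y" for y
  proof (cases "n y = 0")
    case True
    then have "\<forall>i\<in>C. y i = 0" using fin by (simp add: n_def sum_nonneg_eq_0_iff)
    then show ?thesis using True by (simp add: q_def)
  next
    case False
    then have pos: "n y > 0" using sum_nonneg[of C "\<lambda>i. (y i)\<^sup>2"] by (simp add: n_def)
    have "q y \<le> (\<Sum>i\<in>C. \<Sum>j\<in>C. W i j * \<bar>y i\<bar> * \<bar>y j\<bar>)"
      unfolding q_def
    proof (intro sum_mono)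
      fix i j assume "i \<in> C" "j \<in> C"
      then show "W i j * y i * y j \<le> W i j * \<bar>y i\<bar> * \<bar>y j\<bar>"
        using mult_left_mono[OF abs_ge_self nonneg, of i j "y i * y j"]
        by (simp add: abs_mult mult.assoc)
    qed
    also have "\<dots> = n y * q (\<lambda>i. if i \<in> C then \<bar>y i\<bar> / sqrt (n y) else 0)"
      using pos by (simp add: q_def sum_distrib_left)
    also have "\<dots> \<le> n y * q x" using max[OF normalized[OF pos]] pos by simp
    finally show ?thesis by (simp add: mult.commute)
  qed
  \<comment> \<open>First-order optimality at \<open>x\<close> under a perturbation s of the single
    coordinate \<open>k\<close>.\<close>
  have eig: "(\<Sum>j\<in>C. W k j * x j) = q x * x k" if k: "k \<in> C" for k
  proof -
    define r where "r = (\<Sum>j\<in>C. W k j * x j)"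
    define d where "d i = (if i = k then 1 else 0::real)" for i
    have sd: "(\<Sum>i\<in>C. g i * d i) = g k" for g :: "'a \<Rightarrow> real"
      using k fin by (simp add: d_def if_distrib[of "(*) _"] cong: if_cong)
    have ineq: "0 \<le> 2 * s * (q x * x k - r) + s\<^sup>2 * (q x - W k k)" for s
    proof -
      have r2: "(\<Sum>i\<in>C. W i k * x i) = r" unfolding r_def using k sym by (intro sum.cong) auto
      have "n (\<lambda>i. x i + s * d i) = (\<Sum>i\<in>C. (x i)\<^sup>2 + (2 * s * x i) * d i + (s\<^sup>2 * d i) * d i)"
        unfolding n_def by (intro sum.cong) (auto simp: power2_eq_square algebra_simps)
      also have "\<dots> = 1 + 2 * s * x k + s\<^sup>2"
        using nx by (simp only: sum.distrib sd) (simp add: n_def d_def)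
      finally have n1: "n (\<lambda>i. x i + s * d i) = 1 + 2 * s * x k + s\<^sup>2" .
      have "q (\<lambda>i. x i + s * d i) = (\<Sum>i\<in>C. (\<Sum>j\<in>C. W i j * x i * x j) +
          s * (W i k * x i) + (s * (\<Sum>j\<in>C. W i j * x j)) * d i + (s\<^sup>2 * W i k) * d i)"
        unfolding q_def
      proof (intro sum.cong refl)
        fix i assume "i \<in> C"
        have "(\<Sum>j\<in>C. W i j * (x i + s * d i) * (x j + s * d j)) =
           (\<Sum>j\<in>C. W i j * x i * x j + (s * W i j * x i) * d j + s * d i * (W i j * x j) + (s\<^sup>2 * d i * W i j) * d j)"
          by (intro sum.cong) (auto simp: power2_eq_square algebra_simps)
        also have "\<dots> = (\<Sum>j\<in>C. W i j * x i * x j) +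
          s * (W i k * x i) + (s * (\<Sum>j\<in>C. W i j * x j)) * d i + (s\<^sup>2 * W i k) * d i"
          by (simp only: sum.distrib sd) (simp flip: sum_distrib_left)
        finally show "(\<Sum>j\<in>C. W i j * (x i + s * d i) * (x j + s * d j)) = \<dots>" .
      qed
      also have "\<dots> = q x + s * r + s * r + s\<^sup>2 * W k k"
        by (simp only: sum.distrib sd) (simp add: q_def r2 flip: sum_distrib_left r_def)
      finally show ?thesis using rayleigh[of "\<lambda>i. x i + s * d i"] n1 by (simp add: algebra_simps)
    qed
    define a where "a = q x * x k - r"
    \<comment> \<open>At s = -a/b the bound \<open>ineq\<close> is at most -a^2/b, which forces a =
      0. The constant dominates the quadratic coefficient, and the added 1 keeps it
      positive.\<close>
    define b where "b = \<bar>q x - W k k\<bar> + 1"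
    have "b > 0" by (simp add: b_def add_nonneg_pos)
    have "0 \<le> 2 * (- a / b) * a + (- a / b)\<^sup>2 * (q x - W k k)" using ineq[of "- a / b"] by (simp add: a_def)
    also have "\<dots> \<le> 2 * (- a / b) * a + (- a / b)\<^sup>2 * b"
      by (intro add_left_mono mult_left_mono) (auto simp: b_def)
    also have "\<dots> = - (a\<^sup>2) / b"
      using \<open>b > 0\<close> by (simp add: field_simps power2_eq_square)
    finally have "a\<^sup>2 / b \<le> 0" by simp
    then have "a\<^sup>2 \<le> 0" using \<open>b > 0\<close> by (simp add: divide_le_0_iff)
    then have "a = 0" by simp
    then show ?thesis by (simp add: a_def r_def)
  qed
  have pos: "0 < x k" if k: "k \<in> C" for k
  proof (rule ccontr)
    assume "\<not> 0 < x k"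
    then have k0: "x k = 0" using x0[OF k] by simp
    \<comment> \<open>A zero entry spreads: the eigenvalue equation at a zero is a vanishing sum of
      nonnegative terms, so every neighbour is zero too.\<close>
    have "x j = 0" if "(\<lambda>i j. i \<in> C \<and> j \<in> C \<and> 0 < W i j)\<^sup>*\<^sup>* k j" for j
      using that
    proof (induction rule: rtranclp_induct)
      case base then show ?case by (rule k0)
    next
      case (step i j)
      then have "(\<Sum>j\<in>C. W i j * x j) = 0" using eig by simp
      then have "W i j * x j = 0"
        using step fin nonneg x0 by (subst (asm) sum_nonneg_eq_0_iff) auto
      then show ?case using step by simp
    qed
    then have "\<forall>j\<in>C. x j = 0" using irr k by blast
    then show False using nx by (simp add: n_def)
  qed
  show ?thesis using pos eig by blast
qed

text \<open>Ground-state substitution: expanding the square gives two diagonal terms, evaluated by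
  the equation for \<open>F\<close>, and a cross term, evaluated by the equation for \<psi>. The
  left side is the Dirichlet form of \<psi>/F.\<close>

lemma perron_gap_identity:
  fixes M :: "'a \<Rightarrow> 'a \<Rightarrow> real" and F :: "'a \<Rightarrow> real" and \<psi> :: "'a \<Rightarrow> complex"
  assumes sym: "\<And>i j. i \<in> B \<Longrightarrow> j \<in> B \<Longrightarrow> M i j = M j i"
    and pos: "\<And>i. i \<in> B \<Longrightarrow> 0 < F i"
    and F: "\<And>i. i \<in> B \<Longrightarrow> (\<Sum>j\<in>B. M i j * F j) = l * F i"
    and \<psi>: "\<And>i. i \<in> B \<Longrightarrow> (\<Sum>j\<in>B. M i j * \<psi> j) = \<mu> * \<psi> i"
  shows "(\<Sum>i\<in>B. \<Sum>j\<in>B. M i j * F i * F j * (cmod (\<psi> i / F i - \<psi> j / F j))\<^sup>2)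
         = 2 * (l - Re \<mu>) * (\<Sum>i\<in>B. (cmod (\<psi> i))\<^sup>2)"
proof -
  have expand: "M i j * F i * F j * (cmod (\<psi> i / F i - \<psi> j / F j))\<^sup>2 =
      M i j * F j * ((cmod (\<psi> i))\<^sup>2 / F i) + M j i * F i * ((cmod (\<psi> j))\<^sup>2 / F j)
      - 2 * Re (cnj (\<psi> i) * (M i j * \<psi> j))" if "i \<in> B" "j \<in> B" for i j
    using pos[OF that(1)] pos[OF that(2)] sym[OF that]
    unfolding cmod_power2 by (simp add: power2_eq_square field_simps)
  have d: "(\<Sum>i\<in>B. \<Sum>j\<in>B. M i j * F j * ((cmod (\<psi> i))\<^sup>2 / F i)) = l * (\<Sum>i\<in>B. (cmod (\<psi> i))\<^sup>2)"
    unfolding sum_distrib_left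
  proof (intro sum.cong refl)
    fix i assume i: "i \<in> B"
    show "(\<Sum>j\<in>B. M i j * F j * ((cmod (\<psi> i))\<^sup>2 / F i)) = l * (cmod (\<psi> i))\<^sup>2"
      using F[OF i] pos[OF i] by (simp only: flip: sum_distrib_right) simp
  qed
  have o: "(\<Sum>i\<in>B. \<Sum>j\<in>B. Re (cnj (\<psi> i) * (M i j * \<psi> j))) = Re \<mu> * (\<Sum>i\<in>B. (cmod (\<psi> i))\<^sup>2)"
    unfolding sum_distrib_left
  proof (intro sum.cong refl)
    fix i assume i: "i \<in> B"
    have "(\<Sum>j\<in>B. Re (cnj (\<psi> i) * (M i j * \<psi> j))) = Re (cnj (\<psi> i) * (\<mu> * \<psi> i))"
      unfolding \<psi>[OF i, symmetric] by (simp add: sum_distrib_left)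
    also have "\<dots> = Re \<mu> * (cmod (\<psi> i))\<^sup>2"
      unfolding cmod_power2 by (simp add: power2_eq_square algebra_simps)
    finally show "(\<Sum>j\<in>B. Re (cnj (\<psi> i) * (M i j * \<psi> j))) = Re \<mu> * (cmod (\<psi> i))\<^sup>2" .
  qed
  have "(\<Sum>i\<in>B. \<Sum>j\<in>B. M i j * F i * F j * (cmod (\<psi> i / F i - \<psi> j / F j))\<^sup>2) =
    (\<Sum>i\<in>B. \<Sum>j\<in>B. M i j * F j * ((cmod (\<psi> i))\<^sup>2 / F i) + M j i * F i * ((cmod (\<psi> j))\<^sup>2 / F j)
      - 2 * Re (cnj (\<psi> i) * (M i j * \<psi> j)))"
    by (intro sum.cong refl expand)
  also have "\<dots> = (\<Sum>i\<in>B. \<Sum>j\<in>B. M i j * F j * ((cmod (\<psi> i))\<^sup>2 / F i)) +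
     (\<Sum>i\<in>B. \<Sum>j\<in>B. M j i * F i * ((cmod (\<psi> j))\<^sup>2 / F j)) -
     2 * (\<Sum>i\<in>B. \<Sum>j\<in>B. Re (cnj (\<psi> i) * (M i j * \<psi> j)))"
    by (simp only: sum.distrib sum_subtractf sum_distrib_left)
  also have "(\<Sum>i\<in>B. \<Sum>j\<in>B. M j i * F i * ((cmod (\<psi> j))\<^sup>2 / F j)) =
      (\<Sum>i\<in>B. \<Sum>j\<in>B. M i j * F j * ((cmod (\<psi> i))\<^sup>2 / F i))" by (rule sum.swap)
  finally show ?thesis unfolding d o by (simp add: algebra_simps)
qed

section \<open>Configurations with isolated holes and their connectivity\<close>

inductive adjacent_swap :: "'a list \<Rightarrow> 'a list \<Rightarrow> bool" where
  "adjacent_swap (u @ a # b # v) (u @ b # a # v)"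

lemma adjacent_swap_Cons: "adjacent_swap xs ys \<Longrightarrow> adjacent_swap (x # xs) (x # ys)"
  by (erule adjacent_swap.cases) (metis adjacent_swap.intros append_Cons)

lemma adjacent_swaps_Cons: "adjacent_swap\<^sup>*\<^sup>* xs ys \<Longrightarrow> adjacent_swap\<^sup>*\<^sup>* (x # xs) (x # ys)"
  by (induction rule: rtranclp_induct) (auto intro: rtranclp.rtrancl_into_rtrancl adjacent_swap_Cons)

lemma adjacent_swaps_front: "adjacent_swap\<^sup>*\<^sup>* (x # u @ v) (u @ x # v)"
proof (induction u)
  case (Cons a u)
  have "adjacent_swap (x # a # u @ v) (a # x # u @ v)"
    using adjacent_swap.intros[of "[]"] by simp
  moreover have "adjacent_swap\<^sup>*\<^sup>* (a # x # u @ v) (a # u @ x # v)"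
    using Cons by (rule adjacent_swaps_Cons)
  ultimately show ?case by (simp add: converse_rtranclp_into_rtranclp)
qed simp

text \<open>Insertion sort: arrange the tail by induction, then move the head rightwards to its
  place.\<close>

lemma adjacent_swaps_if_mset_eq: "mset xs = mset ys \<Longrightarrow> adjacent_swap\<^sup>*\<^sup>* xs ys"
proof (induction xs arbitrary: ys)
  case (Cons x xs)
  then have "x \<in> set ys" by (metis list.set_intros(1) set_mset_mset)
  then obtain u v where ys: "ys = u @ x # v" by (meson split_list)
  with Cons have "adjacent_swap\<^sup>*\<^sup>* xs (u @ v)" by simp
  then have "adjacent_swap\<^sup>*\<^sup>* (x # xs) (x # u @ v)" by (rule adjacent_swaps_Cons)
  then show ?case unfolding ys using adjacent_swaps_front by (rule rtranclp_trans)
qed simp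

lemma int_crossing:
  fixes a b :: int
  assumes "a < b" "P a" "\<not> P b"
  shows "\<exists>l. a < l \<and> l \<le> b \<and> P (l - 1) \<and> \<not> P l"
proof -
  have "\<not> P b \<longrightarrow> (\<exists>l. a < l \<and> l \<le> b \<and> P (l - 1) \<and> \<not> P l)" using \<open>a < b\<close>
  proof (induction b rule: int_gr_induct)
    case base then show ?case using assms(2) by (auto intro!: exI[of _ "a + 1"])
  next
    case (step i)
    show ?case
    proof (cases "P i")
      case True then show ?thesis using step by (intro impI exI[of _ "i + 1"]) simp
    next
      case False then show ?thesis using step by fastforce
    qed
  qed
  then show ?thesis using assms(3) by blast
qed

locale isolated_holes =
  fixes Ns Ne :: nat and t t' :: real
  assumes even_Ns: "even Ns" and t_pos: "t > 0" and t'_pos: "t' > 0"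
    and odd_Ne: "odd Ne" and Ne_less: "Ne < Ns" and Ns_less: "Ns < 2 * Ne"
begin

text \<open>\<open>Ns\<close> and \<open>2 * Ne\<close> are both even, so the strict inequality
  between them leaves a difference of 2; \<open>Ne = 1\<close> would require 1 < \<open>Ns\<close> <
  2.\<close>

lemma Ne_ge: "3 \<le> Ne" and Ns_ge: "4 \<le> Ns" and Ns_le: "Ns + 2 \<le> 2 * Ne"
proof -
  show "Ns + 2 \<le> 2 * Ne" using even_Ns Ns_less by (auto elim!: evenE)
  show "3 \<le> Ne" using odd_Ne Ne_less Ns_less by (cases "Ne = 1") (auto elim!: oddE)
  then show "4 \<le> Ns" using Ne_less by simp
qed

section \<open>The ring, its hops and its universal cover\<close>

text \<open>The covering map from the integers to the ring; the shifts by 1 match the numbering from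
  1 used by \<open>wrap\<close>.\<close>

definition site :: "int \<Rightarrow> nat" where
  "site z = nat ((z - 1) mod int Ns) + 1"

lemma site_range: "site z \<in> {1..Ns}"
proof -
  have "(z - 1) mod int Ns < int Ns" using Ns_ge by simp
  moreover have "0 \<le> (z - 1) mod int Ns" using Ns_ge by simp
  ultimately show ?thesis by (auto simp: site_def)
qed

lemma int_site: "int (site z) = (z - 1) mod int Ns + 1"
  using Ns_ge by (simp add: site_def)

lemma site_eq_iff: "site z = site z' \<longleftrightarrow> int Ns dvd z - z'"
proof -
  have "site z = site z' \<longleftrightarrow> (z - 1) mod int Ns = (z' - 1) mod int Ns"
    by (metis add_right_cancel int_site of_nat_eq_iff)
  then show ?thesis by (simp add: mod_eq_dvd_iff)
qed

lemma site_of_nat: "x \<in> {1..Ns} \<Longrightarrow> site (int x) = x"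
  by (auto simp: site_def nat_diff_distrib' simp flip: of_nat_diff)

lemma wrap_site: "wrap Ns (site z + k) = site (z + int k)"
proof -
  have "int (wrap Ns (site z + k)) = (int (site z) - 1 + int k) mod int Ns + 1"
    using site_range[of z] by (simp add: wrap_def zmod_int of_nat_diff diff_add_eq)
  also have "\<dots> = int (site (z + int k))"
    unfolding int_site using mod_add_left_eq[of "z - 1" "int Ns" "int k"] by (simp add: diff_add_eq)
  finally show ?thesis by simp
qed

lemma even_site: "even (site z) \<longleftrightarrow> even z"
proof -
  have "even (int (site z)) \<longleftrightarrow> even z"
    unfolding int_site using even_Ns by (simp add: dvd_mod_iff)
  then show ?thesis by simp
qed

lemma wrap_range: "wrap Ns x \<in> {1..Ns}"
  using Ns_ge by (auto simp: wrap_def Suc_le_eq)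

text \<open>The indicators are added rather than joined by a disjunction to count bonds with
  multiplicity: for \<open>Ns = 4\<close> the two t' bonds both join sites 2 and 4, and
  \<open>H_hop\<close> counts both.\<close>

definition hop_amp :: "nat \<Rightarrow> nat \<Rightarrow> real" where
  "hop_amp x y = t * (of_bool (y = wrap Ns (x + 1)) + of_bool (x = wrap Ns (y + 1)))
     + t' * (of_bool (even x \<and> y = wrap Ns (x + 2)) + of_bool (even y \<and> x = wrap Ns (y + 2)))"

lemma hop_amp_nonneg: "0 \<le> hop_amp x y"
  unfolding hop_amp_def using t_pos t'_pos
  by (intro add_nonneg_nonneg mult_nonneg_nonneg) simp_all

lemma hop_amp_sym: "hop_amp x y = hop_amp y x"
  unfolding hop_amp_def by (simp only: add.commute)

lemma hop_amp_step1: "0 < hop_amp (site z) (site (z + 1))"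
proof -
  have "t * 1 \<le> hop_amp (site z) (site (z + 1))"
    unfolding hop_amp_def using t_pos t'_pos wrap_site[of z 1]
    by (intro add_increasing2 mult_left_mono mult_nonneg_nonneg add_nonneg_nonneg) simp_all
  then show ?thesis using t_pos by simp
qed

lemma hop_amp_step2:
  assumes "even z" shows "0 < hop_amp (site z) (site (z + 2))"
proof -
  have "t' * 1 \<le> hop_amp (site z) (site (z + 2))"
    unfolding hop_amp_def using t_pos t'_pos wrap_site[of z 2] assms
    by (intro add_increasing[OF _ mult_left_mono] mult_nonneg_nonneg) (simp_all add: even_site)
  then show ?thesis using t'_pos by simp
qed

definition site_configs :: "nat set set" where
  "site_configs = {X. X \<subseteq> {1..Ns} \<and> card X = Ne \<and> (\<forall>x\<in>{1..Ns}. x \<in> X \<or> wrap Ns (x + 1) \<in> X)}"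

definition spin_configs :: "mode set set" where
  "spin_configs = {S. inj_on fst S \<and> fst ` S \<in> site_configs}"

inductive hop_step :: "mode set \<Rightarrow> mode set \<Rightarrow> bool" where
  "S \<in> spin_configs \<Longrightarrow> insert (y, \<sigma>) (S - {(x, \<sigma>)}) \<in> spin_configs \<Longrightarrow> 0 < hop_amp x y \<Longrightarrow>
   (x, \<sigma>) \<in> S \<Longrightarrow> (y, \<sigma>) \<notin> S \<Longrightarrow> hop_step S (insert (y, \<sigma>) (S - {(x, \<sigma>)}))"

text \<open>Labels separate the two kinds of motion: hops that keep the cyclic order change
  \<open>g\<close> and keep \<open>w\<close>, while an exchange changes \<open>w\<close>.\<close>

definition labelled :: "(nat \<Rightarrow> nat) \<Rightarrow> (nat \<Rightarrow> bool) \<Rightarrow> mode set" where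
  "labelled g w = (\<lambda>k. (g k, w k)) ` {..<Ne}"

lemma labelled_cong:
  "(\<And>k. k < Ne \<Longrightarrow> g k = g' k) \<Longrightarrow> (\<And>k. k < Ne \<Longrightarrow> w k = w' k) \<Longrightarrow> labelled g w = labelled g' w'"
  by (simp add: labelled_def)

lemma labelled_hop:
  assumes "inj_on g {..<Ne}" "k < Ne"
  shows "labelled (g(k := y)) w = insert (y, w k) (labelled g w - {(g k, w k)})"
proof -
  have dom: "{..<Ne} = insert k ({..<Ne} - {k})" using assms(2) by auto
  have "labelled g w - {(g k, w k)} = (\<lambda>l. (g l, w l)) ` ({..<Ne} - {k})"
    unfolding labelled_def using assms by (auto dest: inj_onD)
  moreover have "labelled (g(k := y)) w = insert (y, w k) ((\<lambda>l. (g l, w l)) ` ({..<Ne} - {k}))"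
    unfolding labelled_def by (subst dom) (auto intro!: image_cong)
  ultimately show ?thesis by simp
qed

text \<open>A configuration is unrolled to the universal cover of the ring: electron i sits at the
integer p i, and isolation of the holes says that consecutive electrons are at distance 1 or 2.\<close>

definition lift :: "(int \<Rightarrow> int) \<Rightarrow> bool" where
  "lift p \<longleftrightarrow> (\<forall>i. p (i + int Ne) = p i + int Ns \<and> p i + 1 \<le> p (i + 1) \<and> p (i + 1) \<le> p i + 2)"

lemma lift_step: "lift p \<Longrightarrow> p i + 1 \<le> p (i + 1)" "lift p \<Longrightarrow> p (i + 1) \<le> p i + 2"
  by (auto simp: lift_def)

lemma lift_periodic:
  assumes "lift p" shows "p (i + c * int Ne) = p i + c * int Ns"
proof (induction c rule: int_induct[where k = 0])
  case (step1 c)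
  have "p (i + (c + 1) * int Ne) = p (i + c * int Ne) + int Ns"
    using assms by (metis lift_def add.assoc distrib_right mult_1)
  then show ?case using step1 by (simp add: algebra_simps)
next
  case (step2 c)
  have "p (i + c * int Ne) = p (i + (c - 1) * int Ne) + int Ns"
    using assms by (metis lift_def add.assoc distrib_right mult_1 diff_add_cancel)
  then show ?case using step2 by (simp add: algebra_simps)
qed simp

lemma lift_mod: "lift p \<Longrightarrow> p i = p (i mod int Ne) + (i div int Ne) * int Ns"
  using lift_periodic[of p "i mod int Ne" "i div int Ne"] by simp

lemma lift_strict_mono:
  assumes "lift p" "i < j" shows "p i < p j"
  using assms(2)
proof (induction j rule: int_gr_induct)
  case base then show ?case using lift_step(1)[OF assms(1), of i] by simp
next
  case (step j) then show ?case using lift_step(1)[OF assms(1), of j] by simp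
qed

lemma lift_less_iff: "lift p \<Longrightarrow> p i < p j \<longleftrightarrow> i < j"
  by (metis lift_strict_mono less_asym linorder_neqE)

abbreviation pos :: "(int \<Rightarrow> int) \<Rightarrow> nat \<Rightarrow> nat" where
  "pos p k \<equiv> site (p (int k))"

text \<open>Labels of one period occupy less than a full turn of the cover, so no two of their
  positions differ by a multiple of \<open>Ns\<close>.\<close>

lemma inj_on_pos:
  assumes "lift p" shows "inj_on (pos p) {..<Ne}"
proof (rule linorder_inj_onI)
  fix k l :: nat assume kl: "k < l" "k \<in> {..<Ne}" "l \<in> {..<Ne}"
  have "p (int k) < p (int l)" using assms kl by (simp add: lift_less_iff)
  moreover have "p (int l) < p (int k) + int Ns"
    using assms kl lift_less_iff[OF assms, of "int l" "int k + int Ne"] by (simp add: lift_def)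
  ultimately have "\<not> int Ns dvd p (int l) - p (int k)"
    by (intro zdvd_not_zless) auto
  then show "pos p k \<noteq> pos p l" by (metis site_eq_iff)
qed auto

text \<open>Locate \<open>z\<close> between consecutive values of the unbounded increasing
  \<open>p\<close>; their gap is at most 2.\<close>

lemma lift_dense:
  assumes "lift p" shows "\<exists>i. p i = z \<or> p i = z + 1"
proof -
  have "p 0 + c * int Ns = p (c * int Ne)" for c using lift_periodic[OF assms, of 0 c] by simp
  note per = this[symmetric]
  \<comment> \<open>This many full turns in either direction carry \<open>p\<close> past
    \<open>z\<close>, because one turn moves it by at least 1.\<close>
  define m where "m = \<bar>z\<bar> + \<bar>p 0\<bar> + 1"
  have m: "m \<le> m * int Ns" "0 < m" using Ns_ge by (auto simp: m_def)
  have b: "p 0 - m \<le> z" "z < p 0 + m" by (auto simp: m_def)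
  have lo: "p (- m * int Ne) \<le> z" and hi: "\<not> p (m * int Ne) \<le> z"
    using per[of m] per[of "- m"] m b by (simp_all, linarith+)
  have "- m * int Ne < m * int Ne" using m Ne_ge by auto
  from int_crossing[OF this, of "\<lambda>i. p i \<le> z"] lo hi
  obtain l where "p (l - 1) \<le> z" "z < p l" by auto
  then show ?thesis using lift_step(2)[OF assms, of "l - 1"] by (intro exI[of _ "if p (l-1) = z then l - 1 else l"]) auto
qed

lemma pos_image:
  assumes "lift p" shows "pos p ` {..<Ne} = range (\<lambda>i. site (p i))"
proof -
  have "site (p i) \<in> pos p ` {..<Ne}" for i
  proof -
    have "site (p i) = pos p (nat (i mod int Ne))"
      using lift_mod[OF assms, of i] Ne_ge by (simp add: site_eq_iff)
    moreover have "nat (i mod int Ne) < Ne" using Ne_ge by (simp add: nat_less_iff)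
    ultimately show ?thesis by blast
  qed
  then show ?thesis by auto
qed

lemma pos_image_site_configs:
  assumes "lift p" shows "pos p ` {..<Ne} \<in> site_configs"
proof -
  have "x \<in> pos p ` {..<Ne} \<or> wrap Ns (x + 1) \<in> pos p ` {..<Ne}" if x: "x \<in> {1..Ns}" for x
  proof -
    obtain i where "p i = int x \<or> p i = int x + 1" using lift_dense[OF assms] by blast
    moreover have "wrap Ns (x + 1) = site (int x + 1)"
      using wrap_site[of "int x" 1] site_of_nat[OF x] by simp
    ultimately show ?thesis unfolding pos_image[OF assms]
      using site_of_nat[OF x] by (metis rangeI)
  qed
  moreover have "card (pos p ` {..<Ne}) = Ne" using card_image[OF inj_on_pos[OF assms]] by simp
  ultimately show ?thesis using site_range by (auto simp: site_configs_def)
qed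

lemma fst_labelled: "fst ` labelled g w = g ` {..<Ne}"
  by (auto simp: labelled_def image_iff)

lemma labelled_spin_config:
  assumes "lift p" shows "labelled (pos p) w \<in> spin_configs"
proof -
  have "inj_on fst (labelled (pos p) w)"
    using inj_on_pos[OF assms] by (auto simp: labelled_def inj_on_def)
  then show ?thesis using pos_image_site_configs[OF assms] by (simp add: spin_configs_def fst_labelled)
qed

section \<open>Nearest-neighbour hops as moves of lifts\<close>

text \<open>All periodic images of electron \<open>i\<close> move together, so that the result still
  projects to the ring.\<close>

definition bump :: "(int \<Rightarrow> int) \<Rightarrow> int \<Rightarrow> int \<Rightarrow> int" where
  "bump p i j = (if int Ne dvd j - i then p j + 1 else p j)"

lemma not_Ne_dvd: "0 < a \<Longrightarrow> a < int Ne \<Longrightarrow> int Ne dvd j - i \<Longrightarrow> \<not> int Ne dvd j + a - i"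
  by (metis add.commute add_diff_eq dvd_add_left_iff zdvd_not_zless)

text \<open>The gap on the left grows from 1 to 2 and the one on the right shrinks from 2 to 1, so
  both stay within the permitted range.\<close>

lemma lift_bump:
  assumes p: "lift p" and "p i = p (i - 1) + 1" "p (i + 1) = p i + 2"
  shows "lift (bump p i)"
  unfolding lift_def
proof (intro allI conjI)
  fix j
  have "int Ne dvd j + int Ne - i \<longleftrightarrow> int Ne dvd j - i"
    by (metis add.commute add_diff_eq dvd_add_triv_left_iff)
  then show "bump p i (j + int Ne) = bump p i j + int Ns"
    using p by (simp add: bump_def lift_def)
  have "p (j + 1) = p j + 2" if "int Ne dvd j - i"
  proof -
    from that obtain c where "j - i = int Ne * c" by (elim dvdE)
    then have "j = i + c * int Ne" by (simp add: algebra_simps)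
    then show ?thesis using assms lift_periodic[OF p, of i c] lift_periodic[OF p, of "i + 1" c]
      by (simp add: algebra_simps)
  qed
  have "p (j + 1) = p j + 1" if "int Ne dvd j + 1 - i"
  proof -
    from that obtain c where "j + 1 - i = int Ne * c" by (elim dvdE)
    then have j: "j = i - 1 + c * int Ne" and j1: "j + 1 = i + c * int Ne"
      by (simp_all add: algebra_simps)
    have "p j = p (i - 1) + c * int Ns" by (simp only: j lift_periodic[OF p])
    moreover have "p (j + 1) = p i + c * int Ns" by (simp only: j1 lift_periodic[OF p])
    ultimately show ?thesis using assms by simp
  qed
  \<comment> \<open>Since \<open>Ne\<close> exceeds 1, two consecutive electrons are never both
    images of \<open>i\<close>, and each gap changes at most once.\<close>
  have "\<not> (int Ne dvd j - i \<and> int Ne dvd j + 1 - i)" using not_Ne_dvd[of 1] Ne_ge by auto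
  then consider "int Ne dvd j - i" "\<not> int Ne dvd j + 1 - i" | "\<not> int Ne dvd j - i" "int Ne dvd j + 1 - i"
    | "\<not> int Ne dvd j - i" "\<not> int Ne dvd j + 1 - i" by blast
  then have "bump p i j + 1 \<le> bump p i (j + 1) \<and> bump p i (j + 1) \<le> bump p i j + 2"
  proof cases
    case 1
    then show ?thesis unfolding bump_def using \<open>int Ne dvd j - i \<Longrightarrow> p (j + 1) = p j + 2\<close> by (simp only: if_True if_False) simp
  next
    case 2
    then show ?thesis unfolding bump_def using \<open>int Ne dvd j + 1 - i \<Longrightarrow> p (j + 1) = p j + 1\<close> by (simp only: if_True if_False) simp
  next
    case 3
    then show ?thesis unfolding bump_def using lift_step[OF p, of j] by (simp only: if_True if_False)
  qed
  then show "bump p i j + 1 \<le> bump p i (j + 1)" "bump p i (j + 1) \<le> bump p i j + 2" by blast+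
qed

lemma bump_hop:
  assumes p: "lift p" and "p i = p (i - 1) + 1" "p (i + 1) = p i + 2"
  shows "hop_step (labelled (pos p) w) (labelled (pos (bump p i)) w)"
proof -
  \<comment> \<open>The image of electron \<open>i\<close> among the labels used by
    \<open>labelled\<close>.\<close>
  define k where "k = nat (i mod int Ne)"
  have k: "k < Ne" and ik: "int k = i mod int Ne" using Ne_ge by (simp_all add: k_def nat_less_iff)
  have b: "pos (bump p i) l = ((pos p)(k := site (p (int k) + 1))) l" if "l < Ne" for l
  proof -
    have "int Ne dvd int l - i \<longleftrightarrow> l = k"
      using that k by (metis ik mod_eq_dvd_iff mod_pos_pos_trivial of_nat_0_le_iff of_nat_less_iff of_nat_eq_iff)
    then show ?thesis by (simp add: bump_def)
  qed
  note lb = lift_bump[OF assms]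
  have eq: "labelled (pos (bump p i)) w = insert (site (p (int k) + 1), w k) (labelled (pos p) w - {(pos p k, w k)})"
    by (rule trans[OF labelled_cong[OF b refl] labelled_hop[OF inj_on_pos[OF p] k]])
  have "site (p (int k) + 1) \<noteq> pos p l" if "l < Ne" for l
  proof (cases "l = k")
    case True
    have "\<not> int Ns dvd 1" using Ns_ge by auto
    then show ?thesis using True by (simp add: site_eq_iff)
  next
    case False
    then have "pos (bump p i) l \<noteq> pos (bump p i) k" using inj_on_pos[OF lb] k that by (auto simp: inj_on_def)
    then show ?thesis using b[OF k] b[OF that] False by simp
  qed
  then have "(site (p (int k) + 1), w k) \<notin> labelled (pos p) w" by (auto simp: labelled_def)
  moreover have "(pos p k, w k) \<in> labelled (pos p) w" using k by (auto simp: labelled_def)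
  ultimately show ?thesis unfolding eq
    using labelled_spin_config[OF p, of w] labelled_spin_config[OF lb, of w] hop_amp_step1
    by (intro hop_step.intros) (simp_all add: eq)
qed

end

lemma int_succ_div_mod:
  fixes i N :: int
  assumes "0 < N"
  shows "i mod N + 1 < N \<Longrightarrow> (i + 1) mod N = i mod N + 1 \<and> (i + 1) div N = i div N"
    and "\<not> i mod N + 1 < N \<Longrightarrow> i mod N = N - 1 \<and> (i + 1) mod N = 0 \<and> (i + 1) div N = i div N + 1"
proof -
  have i: "i = N * (i div N) + i mod N" by simp
  show "(i + 1) mod N = i mod N + 1 \<and> (i + 1) div N = i div N" if "i mod N + 1 < N"
    using int_div_pos_eq[of "i + 1" N "i div N" "i mod N + 1"] int_mod_pos_eq[of "i + 1" N "i div N" "i mod N + 1"]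
      that i pos_mod_sign[OF assms, of i] by linarith
  show "i mod N = N - 1 \<and> (i + 1) mod N = 0 \<and> (i + 1) div N = i div N + 1" if "\<not> i mod N + 1 < N"
  proof -
    have m: "i mod N = N - 1" using that pos_mod_bound[OF assms, of i] by linarith
    have "i + 1 = N * (i div N + 1) + 0" using i m by (simp add: distrib_left)
    then show ?thesis using m assms int_div_pos_eq[of "i + 1" N "i div N + 1" 0] int_mod_pos_eq[of "i + 1" N "i div N + 1" 0] by blast
  qed
qed

context isolated_holes begin

text \<open>With a constant gap c one would have \<open>Ns = c * Ne\<close>, but \<open>Ns\<close>
  lies strictly between \<open>Ne\<close> and \<open>2 * Ne\<close>.\<close>

lemma lift_has_steps:
  assumes "lift p"
  shows "\<exists>i. p (i + 1) = p i + 1" "\<exists>i. p (i + 1) = p i + 2"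
proof -
  have "p (int n) = p 0 + c * int n" if "\<And>i. p (i + 1) = p i + c" for c n
  proof (induction n)
    case (Suc n)
    then show ?case using that[of "int n"] by (simp add: algebra_simps)
  qed simp
  then have all: "int Ns = c * int Ne" if "\<And>i. p (i + 1) = p i + c" for c
    using that lift_periodic[OF assms, of 0 1] by (metis add_left_cancel mult_1 add_0)
  have d: "p (i + 1) = p i + 1 \<or> p (i + 1) = p i + 2" for i
    using lift_step[OF assms, of i] by linarith
  have "\<not> (\<forall>i. p (i + 1) = p i + 2)" using all[of 2] Ns_less by fastforce
  then show "\<exists>i. p (i + 1) = p i + 1" using d by blast
  have "\<not> (\<forall>i. p (i + 1) = p i + 1)" using all[of 1] Ne_less by fastforce
  then show "\<exists>i. p (i + 1) = p i + 2" using d by blast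
qed

text \<open>Lifts form a lattice under the pointwise order, and nearest-neighbour hops are its covering
relations. Since adding a multiple of Ns to a lift does not change the configuration, any two
configurations with the same cyclic spin sequence are connected.\<close>

lemma lift_raise:
  assumes p: "lift p" and q: "lift q" and le: "\<And>i. p i \<le> q i" and ne: "p a < q a"
  shows "\<exists>i. p i < q i \<and> p i = p (i - 1) + 1 \<and> p (i + 1) = p i + 2"
proof -
  have gt: "\<exists>c. x < b + c * int Ne" for x b :: int
  proof
    show "x < b + (\<bar>x\<bar> + \<bar>b\<bar> + 1) * int Ne"
    proof -
      have "(\<bar>x\<bar> + \<bar>b\<bar> + 1) * 1 \<le> (\<bar>x\<bar> + \<bar>b\<bar> + 1) * int Ne"
        using Ne_ge by (intro mult_left_mono) auto
      then show ?thesis unfolding mult_1_right using abs_ge_self[of x] abs_ge_minus_self[of b] by linarith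
    qed
  qed
  have lt: "\<exists>c. b + c * int Ne < x" for x b :: int
  proof -
    obtain c where "- x < - b + c * int Ne" using gt by blast
    then show ?thesis by (intro exI[of _ "- c"]) simp
  qed
  \<comment> \<open>Between a gap of 1 and a later gap of 2 there is an electron where the gap
    switches from 1 to 2, and that electron can be bumped.\<close>
  have cross: "\<exists>i. a' < i \<and> i \<le> b' \<and> p i = p (i - 1) + 1 \<and> p (i + 1) = p i + 2"
    if ab: "a' < b'" "p (a' + 1) = p a' + 1" "p (b' + 1) = p b' + 2" for a' b'
  proof -
    obtain l where l: "a' < l" "l \<le> b'" "p (l - 1 + 1) = p (l - 1) + 1" "p (l + 1) \<noteq> p l + 1"
      using int_crossing[of a' b' "\<lambda>i. p (i + 1) = p i + 1", OF ab(1,2)] ab(3) by (metis add_left_cancel one_eq_numeral_iff semiring_norm(85))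
    then have "p (l + 1) = p l + 2" using lift_step[OF p, of l] by linarith
    then show ?thesis using l by auto
  qed
  show ?thesis
  proof (cases "\<forall>i. p i < q i")
    case True
    \<comment> \<open>Without contact between \<open>p\<close> and \<open>q\<close> every bump stays
      below \<open>q\<close>. Periodicity places some gap of 2 to the right of a gap of 1.\<close>
    obtain a' b where ab: "p (a' + 1) = p a' + 1" "p (b + 1) = p b + 2" using lift_has_steps[OF p] by blast
    obtain c where "a' < b + c * int Ne" using gt by blast
    moreover have "p (b + c * int Ne + 1) = p (b + c * int Ne) + 2"
      using ab lift_periodic[OF p, of b c] lift_periodic[OF p, of "b + 1" c] by (simp add: algebra_simps)
    ultimately show ?thesis using cross ab True by blast
  next
    case False
    then obtain b where b: "p b = q b" using le by (metis order_le_less)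
    then have eq: "p (b + c * int Ne) = q (b + c * int Ne)" for c by (simp add: lift_periodic p q)
    obtain c where c: "a < b + c * int Ne" using gt by blast
    \<comment> \<open>Contacts recur with period \<open>Ne\<close>, so \<open>a\<close> lies
      strictly between two nearest contacts: \<open>b'\<close> on the right and, below,
      \<open>a'\<close> on the left.\<close>
    obtain b' where b': "a < b'" "p (b' - 1) < q (b' - 1)" "\<not> p b' < q b'"
      and b'_min: "\<And>i. a \<le> i \<Longrightarrow> i < b' \<Longrightarrow> p i < q i"
    proof -
      define n where "n = (LEAST n. \<not> p (a + int n) < q (a + int n))"
      have ex: "\<not> p (a + int (nat (b + c * int Ne - a))) < q (a + int (nat (b + c * int Ne - a)))"
        using c eq[of c] by simp
      have n: "\<not> p (a + int n) < q (a + int n)" unfolding n_def by (rule LeastI, rule ex)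
      have less: "p (a + int m) < q (a + int m)" if "m < n" for m
        using not_less_Least that unfolding n_def by blast
      have "n \<noteq> 0" using n ne by (metis add_0_right of_nat_0)
      then have 1: "a + int n - 1 = a + int (n - 1)" by simp
      show ?thesis
      proof (rule that[of "a + int n"])
        show "p (a + int n - 1) < q (a + int n - 1)" unfolding 1 using \<open>n \<noteq> 0\<close> by (intro less) simp
        show "p i < q i" if "a \<le> i" "i < a + int n" for i
          using less[of "nat (i - a)"] that by simp
      qed (use n \<open>n \<noteq> 0\<close> in auto)
    qed
    obtain d where d: "b + d * int Ne < a" using lt by blast
    obtain a' where a': "a' < a" "\<not> p a' < q a'" "\<And>i. a' < i \<Longrightarrow> i \<le> a \<Longrightarrow> p i < q i"
    proof -
      define n where "n = (LEAST n. \<not> p (a - int n) < q (a - int n))"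
      have ex: "\<not> p (a - int (nat (a - (b + d * int Ne)))) < q (a - int (nat (a - (b + d * int Ne))))"
        using d eq[of d] by simp
      have n: "\<not> p (a - int n) < q (a - int n)" unfolding n_def by (rule LeastI, rule ex)
      have less: "p (a - int m) < q (a - int m)" if "m < n" for m
        using not_less_Least that unfolding n_def by blast
      have "n \<noteq> 0" using n ne by (metis diff_zero of_nat_0)
      show ?thesis
      proof (rule that[of "a - int n"])
        show "p i < q i" if "a - int n < i" "i \<le> a" for i
          using less[of "nat (a - i)"] that by simp
      qed (use n \<open>n \<noteq> 0\<close> in auto)
    qed
    have "p (a' + 1) < q (a' + 1)" using a' by simp
    \<comment> \<open>On leaving the contact \<open>q\<close> advances by at most 2 and overtakes
      \<open>p\<close>, so \<open>p\<close> advances by 1. At \<open>b'\<close> it is the reverse: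
      \<open>p\<close> catches up with \<open>q\<close> and must advance by 2. A bumpable electron
      thus lies strictly between the contacts, where \<open>p\<close> is below
      \<open>q\<close>.\<close>
    then have s1: "p (a' + 1) = p a' + 1"
      using a'(2) le[of a'] lift_step[OF p, of a'] lift_step[OF q, of a'] by linarith
    have s2: "p (b' - 1 + 1) = p (b' - 1) + 2"
      using b'(2,3) le[of b'] lift_step[OF p, of "b' - 1"] lift_step[OF q, of "b' - 1"] by simp
    have "a' < b' - 1" using a' b' by (metis b'(2) a'(2) linorder_not_less order_le_less zle_diff1_eq less_trans)
    then obtain i where i: "a' < i" "i \<le> b' - 1" "p i = p (i - 1) + 1" "p (i + 1) = p i + 2"
      using cross[OF _ s1 s2] by blast
    have "p i < q i" using i(1,2) a'(3)[of i] b'_min[of i] by linarith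
    then show ?thesis using i by blast
  qed
qed

lemma lift_le_connected:
  assumes "lift p" "lift q" "\<And>i. p i \<le> q i"
  shows "hop_step\<^sup>*\<^sup>* (labelled (pos p) w) (labelled (pos q) w)"
  using assms
\<comment> \<open>The measure is the total displacement still to be made within one period; each
  bump lowers it.\<close>
proof (induction "nat (\<Sum>k<Ne. q (int k) - p (int k))" arbitrary: p rule: less_induct)
  case (less p)
  show ?case
  proof (cases "p = q")
    case False
    then obtain a where "p a < q a" using less.prems(3) by (metis ext order_le_less)
    then obtain i where i: "p i < q i" "p i = p (i - 1) + 1" "p (i + 1) = p i + 2"
      using lift_raise less.prems by metis
    have lb: "lift (bump p i)" using lift_bump i less.prems by blast
    have le: "bump p i j \<le> q j" for j
    proof (cases "int Ne dvd j - i")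
      case True
      then obtain c where "j - i = int Ne * c" by (elim dvdE)
      then have "j = i + c * int Ne" by (simp add: algebra_simps)
      then have "p j < q j" using i less.prems by (simp add: lift_periodic)
      then show ?thesis using True by (simp add: bump_def)
    qed (simp add: bump_def less.prems)
    define k where "k = nat (i mod int Ne)"
    have "int Ne dvd i mod int Ne - i"
      by (metis mod_eq_dvd_iff mod_mod_trivial)
    then have k: "k < Ne" "int Ne dvd int k - i" using Ne_ge by (simp_all add: k_def nat_less_iff)
    have "(\<Sum>k<Ne. q (int k) - bump p i (int k)) < (\<Sum>k<Ne. q (int k) - p (int k))"
    proof (rule sum_strict_mono_ex1)
      show "\<forall>x\<in>{..<Ne}. q (int x) - bump p i (int x) \<le> q (int x) - p (int x)" by (simp add: bump_def)
      show "\<exists>a\<in>{..<Ne}. q (int a) - bump p i (int a) < q (int a) - p (int a)"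
        using k by (intro bexI[of _ k]) (simp_all add: bump_def)
    qed simp
    moreover have "0 \<le> (\<Sum>k<Ne. q (int k) - bump p i (int k))" using le by (intro sum_nonneg) simp
    ultimately have "nat (\<Sum>k<Ne. q (int k) - bump p i (int k)) < nat (\<Sum>k<Ne. q (int k) - p (int k))"
      by simp
    from less.hyps[OF this lb less.prems(2) le] bump_hop[OF less.prems(1) i(2,3)] show ?thesis
      by (rule converse_rtranclp_into_rtranclp[rotated])
  qed simp
qed

lemma lift_connected:
  assumes p: "lift p" and q: "lift q"
  shows "hop_step\<^sup>*\<^sup>* (labelled (pos p) w) (labelled (pos q) w)"
proof -
  \<comment> \<open>Enough full turns to lift \<open>q\<close> above \<open>p\<close> everywhere;
    the extra turn absorbs the variation of \<open>p\<close> within one period.\<close>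
  define c where "c = \<bar>p 0 - q 0\<bar> + 1"
  define q' where "q' i = q i + c * int Ns" for i
  have q': "lift q'" using q by (simp add: q'_def lift_def algebra_simps)
  have "p i \<le> q' i" for i
  proof -
    define r where "r = i mod int Ne"
    have r: "0 \<le> r" "r < int Ne" using Ne_ge by (simp_all add: r_def)
    have "p r < p 0 + int Ns" using lift_strict_mono[OF p r(2)] lift_periodic[OF p, of 0 1] by simp
    moreover have "q 0 \<le> q r" using lift_strict_mono[OF q, of 0 r] r by (cases "r = 0") auto
    moreover have "\<bar>p 0 - q 0\<bar> * 1 \<le> \<bar>p 0 - q 0\<bar> * int Ns" using Ns_ge by (intro mult_left_mono) auto
    ultimately have "p r \<le> q' r" by (simp add: q'_def c_def algebra_simps)
    then show ?thesis using lift_mod[OF p, of i] lift_mod[OF q', of i] by (simp add: r_def)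
  qed
  then have "hop_step\<^sup>*\<^sup>* (labelled (pos p) w) (labelled (pos q') w)"
    using lift_le_connected p q' by blast
  moreover have "labelled (pos q') w = labelled (pos q) w"
    by (intro labelled_cong) (simp_all add: site_eq_iff q'_def)
  ultimately show ?thesis by simp
qed

text \<open>The next-nearest-neighbour hop lets electron k jump over electron k+1. Undoing the displacement
by nearest-neighbour hops leaves a transposition of the two spins.\<close>

lemma exchange_hop:
  assumes p: "lift p" and k: "Suc k < Ne" and ev: "even (p (int k))"
    and p0: "p (int k) = p (int k - 1) + 1" and p1: "p (int k + 1) = p (int k) + 1"
    and p2: "p (int k + 2) = p (int k) + 3"
  shows "hop_step\<^sup>*\<^sup>* (labelled (pos p) w) (labelled (pos p) (w(k := w (Suc k), Suc k := w k)))"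
proof -
  \<comment> \<open>Around P = \<open>p (int k)\<close> the sites P-1, P, P+1, P+3 are occupied and
    P+2 is a hole. Bumping electron k+1 and then electron k gives the lift \<open>p'\<close> with
    these two at P+2 and P+1. The jump of electron k from P to P+2 occupies the same sites with the
    two electrons in reverse order.\<close>
  define b where "b = bump p (int k + 1)"
  define p' where "p' = bump b (int k)"
  have nd: "\<not> int Ne dvd d" if "0 < \<bar>d\<bar>" "\<bar>d\<bar> < int Ne" for d
    using that zdvd_not_zless[of "\<bar>d\<bar>"] by simp
  have b: "lift b" unfolding b_def using p p1 p2 by (intro lift_bump) (simp_all add: add.assoc)
  have bk: "b (int k) = p (int k)" "b (int k + 1) = p (int k) + 2" "b (int k - 1) = p (int k - 1)"
    using nd[of "-1"] nd[of "-2"] Ne_ge p1 by (simp_all add: b_def bump_def)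
  have p': "lift p'" unfolding p'_def using b bk p0 by (intro lift_bump) simp_all
  have v: "p' (int l) = (if l = k then p (int k) + 1 else if l = Suc k then p (int k) + 2 else p (int l))"
    if "l < Ne" for l
  proof -
    have "l = k" if "int Ne dvd int l - int k" using nd[of "int l - int k"] that \<open>l < Ne\<close> k by linarith
    moreover have "l = Suc k" if "int Ne dvd int l - (int k + 1)"
      using nd[of "int l - (int k + 1)"] that \<open>l < Ne\<close> k by linarith
    ultimately have "int Ne dvd int l - int k \<longleftrightarrow> l = k" "int Ne dvd int l - (int k + 1) \<longleftrightarrow> l = Suc k"
      by auto
    then show ?thesis using p1 by (auto simp: p'_def b_def bump_def algebra_simps)
  qed
  let ?g = "(pos p)(k := site (p (int k) + 2))"
  let ?w = "w(k := w (Suc k), Suc k := w k)"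
  have eq: "labelled ?g w = labelled (pos p') ?w"
  proof -
    \<comment> \<open>The transposition of the two labels reindexes one description of the
      configuration into the other.\<close>
    define \<tau> where "\<tau> l = (if l = k then Suc k else if l = Suc k then k else l)" for l
    have "\<tau> ` {..<Ne} = {..<Ne}"
    proof
      show "\<tau> ` {..<Ne} \<subseteq> {..<Ne}" using k by (auto simp: \<tau>_def)
      have "\<tau> (\<tau> l) = l" for l by (simp add: \<tau>_def)
      then show "{..<Ne} \<subseteq> \<tau> ` {..<Ne}" using \<open>\<tau> ` {..<Ne} \<subseteq> {..<Ne}\<close> by (metis image_eqI image_subset_iff subsetI)
    qed
    then have "labelled (pos p') ?w = (\<lambda>l. (pos p' l, ?w l)) ` \<tau> ` {..<Ne}"
      by (simp only: labelled_def)
    also have "\<dots> = (\<lambda>l. (pos p' (\<tau> l), ?w (\<tau> l))) ` {..<Ne}"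
      by (simp only: image_image)
    also have "\<dots> = labelled ?g w" unfolding labelled_def
    proof (intro image_cong refl)
      fix l assume "l \<in> {..<Ne}"
      then have "\<tau> l < Ne" using k by (auto simp: \<tau>_def)
      then show "(pos p' (\<tau> l), ?w (\<tau> l)) = (?g l, w l)"
        using p1 by (simp add: v) (auto simp: \<tau>_def add.commute)
    qed
    finally show ?thesis by simp
  qed
  have S': "insert (site (p (int k) + 2), w k) (labelled (pos p) w - {(pos p k, w k)}) = labelled (pos p') ?w"
    using labelled_hop[OF inj_on_pos[OF p]] k eq by simp
  have "site (p (int k) + 2) \<noteq> pos p l" if "l < Ne" for l
  proof (cases "l = k")
    case True
    have "\<not> int Ns dvd 2" using zdvd_imp_le[of "int Ns" 2] Ns_ge by auto
    then show ?thesis using True by (simp add: site_eq_iff)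
  next
    case False
    \<comment> \<open>The label that occupies the old position of \<open>l\<close> in
      \<open>p'\<close>; it differs from \<open>Suc k\<close>, which holds the target site.\<close>
    define m where "m = (if l = Suc k then k else l)"
    have m: "m < Ne" "m \<noteq> Suc k" using that k False by (auto simp: m_def)
    then have "pos p' (Suc k) \<noteq> pos p' m" using inj_on_pos[OF p'] k by (auto simp: inj_on_def)
    then show ?thesis using v[OF k] v[OF m(1)] False p1 by (auto simp: m_def add.commute split: if_splits)
  qed
  then have "(site (p (int k) + 2), w k) \<notin> labelled (pos p) w" by (auto simp: labelled_def)
  moreover have "(pos p k, w k) \<in> labelled (pos p) w" using k by (auto simp: labelled_def)
  ultimately have hop: "hop_step (labelled (pos p) w) (labelled (pos p') ?w)"
    unfolding S'[symmetric]
    using labelled_spin_config[OF p, of w] labelled_spin_config[OF p', of ?w] hop_amp_step2[OF ev]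
    by (intro hop_step.intros) (simp_all only: S' not_False_eq_True)
  show ?thesis by (rule converse_rtranclp_into_rtranclp[OF hop lift_connected[OF p' p]])
qed

text \<open>Provides the local shape required by exchange_hop around label 0. It exists because Ns is even,
so that at least two gaps between consecutive electrons carry no hole.\<close>

definition base_lift :: "int \<Rightarrow> int" where
  "base_lift i = (let r = i mod int Ne in r + min (max (r - 1) 0) (int Ns - int Ne) + (i div int Ne) * int Ns)"

lemma lift_base: "lift base_lift"
  unfolding lift_def
proof (intro allI conjI)
  fix i
  show "base_lift (i + int Ne) = base_lift i + int Ns"
    using Ne_ge by (simp add: base_lift_def Let_def algebra_simps)
  define r where "r = i mod int Ne"
  have r: "0 \<le> r" "r < int Ne" using Ne_ge by (simp_all add: r_def)
  show "base_lift i + 1 \<le> base_lift (i + 1)" "base_lift (i + 1) \<le> base_lift i + 2"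
  proof -
    have "base_lift i + 1 \<le> base_lift (i + 1) \<and> base_lift (i + 1) \<le> base_lift i + 2"
    proof (cases "r + 1 < int Ne")
      case True
      then have "(i + 1) mod int Ne = r + 1 \<and> (i + 1) div int Ne = i div int Ne"
        unfolding r_def using Ne_ge by (intro int_succ_div_mod) auto
      then show ?thesis using True r by (auto simp: base_lift_def Let_def r_def[symmetric])
    next
      case False
      then have re: "r = int Ne - 1" and "(i + 1) mod int Ne = 0 \<and> (i + 1) div int Ne = i div int Ne + 1"
        unfolding r_def using Ne_ge int_succ_div_mod(2)[of "int Ne" i] by auto
      \<comment> \<open>By \<open>Ns_le\<close> all \<open>Ns - Ne\<close> holes are already used up
        at label \<open>Ne - 1\<close>, so the period closes with a gap of 1.\<close>
      then show ?thesis using re Ns_le Ne_ge Ne_less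
        by (auto simp: base_lift_def Let_def r_def[symmetric] algebra_simps)
    qed
    then show "base_lift i + 1 \<le> base_lift (i + 1)" "base_lift (i + 1) \<le> base_lift i + 2" by auto
  qed
qed

lemma base_lift_values: "base_lift (-1) = -1" "base_lift 0 = 0" "base_lift 1 = 1" "base_lift 2 = 3"
proof -
  have "(-1) mod int Ne = int Ne - 1" "(-1) div int Ne = -1"
    using Ne_ge by (simp_all add: zmod_minus1 div_eq_minus1)
  then show "base_lift (-1) = -1" using Ns_le Ne_ge Ne_less by (simp add: base_lift_def)
qed (use Ne_ge Ne_less in \<open>simp_all add: base_lift_def\<close>)

text \<open>Conjugation: transport the electrons to a standard position, exchange there, and
  transport them back. The standard position is \<open>base_lift\<close> relabelled so that electron
  \<open>k\<close> sits at 0, an even coordinate.\<close>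

lemma exchange_connected:
  assumes p: "lift p" and k: "Suc k < Ne"
  shows "hop_step\<^sup>*\<^sup>* (labelled (pos p) w) (labelled (pos p) (w(k := w (Suc k), Suc k := w k)))"
proof -
  define q where "q i = base_lift (i - int k)" for i
  have shift: "i + c - int k = i - int k + c" for i c by simp
  have q: "lift q" unfolding lift_def q_def shift using lift_base[unfolded lift_def] by blast
  have qv: "q (int k - 1) = -1" "q (int k) = 0" "q (int k + 1) = 1" "q (int k + 2) = 3"
    using base_lift_values by (simp_all add: q_def)
  have "hop_step\<^sup>*\<^sup>* (labelled (pos q) w) (labelled (pos q) (w(k := w (Suc k), Suc k := w k)))"
    by (rule exchange_hop[OF q k]) (simp_all add: qv)
  from rtranclp_trans[OF rtranclp_trans[OF lift_connected[OF p q] this] lift_connected[OF q p]]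
  show ?thesis .
qed

text \<open>Exchanges of neighbouring labels generate all rearrangements, and a list of booleans of
  fixed length is determined up to order by its number of \<open>True\<close> entries.\<close>

lemma spins_connected:
  assumes p: "lift p" and w: "card {k. k < Ne \<and> w k} = card {k. k < Ne \<and> w' k}"
  shows "hop_step\<^sup>*\<^sup>* (labelled (pos p) w) (labelled (pos p) w')"
proof -
  let ?ws = "map w [0..<Ne]" and ?ws' = "map w' [0..<Ne]"
  have cnt: "count (mset (map v [0..<Ne])) True = card {k. k < Ne \<and> v k}" for v
    unfolding count_mset count_list_eq_length_filter length_filter_conv_card by (intro arg_cong[where f = card]) auto
  have tot: "count (mset xs) True + count (mset xs) False = length xs" for xs
    by (induction xs) auto
  have "count (mset ?ws) a = count (mset ?ws') a" for a
    using cnt[of w] cnt[of w'] tot[of ?ws] tot[of ?ws'] w by (cases a) auto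
  then have "mset ?ws = mset ?ws'" by (rule multiset_eqI)
  then have "adjacent_swap\<^sup>*\<^sup>* ?ws ?ws'" by (rule adjacent_swaps_if_mset_eq)
  then have "length ?ws' = Ne \<and> hop_step\<^sup>*\<^sup>* (labelled (pos p) ((!) ?ws)) (labelled (pos p) ((!) ?ws'))"
  proof (induction rule: rtranclp_induct)
    case (step ys zs)
    from step(2) obtain u a b v where ys: "ys = u @ a # b # v" and zs: "zs = u @ b # a # v"
      by (auto elim: adjacent_swap.cases)
    let ?k = "length u"
    have k: "Suc ?k < Ne" using step(3) ys by simp
    have "(!) zs = ((!) ys)(?k := ys ! Suc ?k, Suc ?k := ys ! ?k)"
    proof
      fix l
      consider "l < ?k" | "l = ?k" | "l = Suc ?k" | n where "l = Suc (Suc (?k + n))"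
      proof -
        have "l < ?k \<or> l = ?k \<or> l = Suc ?k \<or> l = Suc (Suc (?k + (l - Suc (Suc ?k))))" by linarith
        then show ?thesis using that by blast
      qed
      then show "zs ! l = (((!) ys)(?k := ys ! Suc ?k, Suc ?k := ys ! ?k)) l"
        by cases (simp_all add: ys zs nth_append)
    qed
    then have hop: "hop_step\<^sup>*\<^sup>* (labelled (pos p) ((!) ys)) (labelled (pos p) ((!) zs))"
      using exchange_connected[OF p k, of "(!) ys"] by simp
    moreover have "length zs = length ys" by (simp add: ys zs)
    ultimately show ?case using step(3) rtranclp_trans[OF conjunct2[OF step(3)] hop] by simp
  qed simp
  then show ?thesis using labelled_cong[of "pos p" "pos p" "(!) ?ws" w] labelled_cong[of "pos p" "pos p" "(!) ?ws'" w']
    by simp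
qed

section \<open>Every configuration comes from a lift\<close>

lemma spin_configs_labelled:
  assumes S: "S \<in> spin_configs"
  shows "\<exists>p w. lift p \<and> S = labelled (pos p) w"
proof -
  define X where "X = fst ` S"
  have X: "X \<subseteq> {1..Ns}" "card X = Ne" and dense: "\<And>x. x \<in> {1..Ns} \<Longrightarrow> x \<in> X \<or> wrap Ns (x + 1) \<in> X"
    using S by (auto simp: spin_configs_def site_configs_def X_def)
  have "finite X" using X(1) finite_subset by blast
  define xs where "xs = sorted_list_of_set X"
  have xs: "set xs = X" "length xs = Ne" "sorted_wrt (<) xs"
    using \<open>finite X\<close> X by (simp_all add: xs_def)
  \<comment> \<open>The sorted occupied sites, continued periodically to the cover.\<close>
  define p where "p i = int (xs ! nat (i mod int Ne)) + (i div int Ne) * int Ns" for i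
  have m: "nat (i mod int Ne) < Ne" for i using Ne_ge by (simp add: nat_less_iff)
  have rng: "xs ! nat (i mod int Ne) \<in> X" for i using m[of i] xs nth_mem by metis
  have per: "p (i + int Ne) = p i + int Ns" for i using Ne_ge by (simp add: p_def algebra_simps)
  have inc: "p i < p (i + 1)" for i
  proof (cases "i mod int Ne + 1 < int Ne")
    case True
    then have "(i + 1) mod int Ne = i mod int Ne + 1 \<and> (i + 1) div int Ne = i div int Ne"
      using Ne_ge by (intro int_succ_div_mod) auto
    then show ?thesis using True xs sorted_wrt_nth_less[OF xs(3), of "nat (i mod int Ne)" "nat (i mod int Ne + 1)"] Ne_ge
      by (simp add: p_def nat_less_iff)
  next
    case False
    then have "(i + 1) mod int Ne = 0 \<and> (i + 1) div int Ne = i div int Ne + 1"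
      using Ne_ge int_succ_div_mod(2)[of "int Ne" i] by auto
    moreover have "xs ! nat (i mod int Ne) \<in> {1..Ns}" "xs ! 0 \<in> {1..Ns}"
      using subsetD[OF X(1) rng[of i]] subsetD[OF X(1) rng[of 0]] by simp_all
    ultimately show ?thesis by (simp add: p_def algebra_simps)
  qed
  have mono: "p i < p j" if "i < j" for i j using that
  proof (induction j rule: int_gr_induct)
    case base show ?case by (rule inc)
  next
    case (step j) show ?case by (rule less_trans[OF step(2) inc])
  qed
  have site_p: "site (p i) = xs ! nat (i mod int Ne)" for i
  proof -
    have "site (p i) = site (int (xs ! nat (i mod int Ne)))" by (simp add: p_def site_eq_iff)
    then show ?thesis using site_of_nat[OF subsetD[OF X(1) rng]] by simp
  qed
  have range: "z \<in> range p" if "site z \<in> X" for z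
  proof -
    have "site z \<in> set xs" using that by (simp add: xs(1))
    then obtain k where k: "k < Ne" "xs ! k = site z" by (auto simp: in_set_conv_nth xs(2))
    then have "site z = site (p (int k))" by (simp add: site_p)
    then obtain c where "z - p (int k) = int Ns * c" by (auto simp: site_eq_iff elim: dvdE)
    moreover have "p (int k + c * int Ne) = p (int k) + c * int Ns"
      using Ne_ge by (simp add: p_def algebra_simps)
    ultimately have "z = p (int k + c * int Ne)" by (simp add: algebra_simps)
    then show ?thesis by blast
  qed
  \<comment> \<open>A gap above 2 would leave the two sites following \<open>p i\<close> both empty,
    contradicting the isolation of the holes.\<close>
  have le2: "p (i + 1) \<le> p i + 2" for i
  proof (rule ccontr)
    assume a: "\<not> p (i + 1) \<le> p i + 2"
    have gap: "z \<notin> range p" if "p i < z" "z < p (i + 1)" for z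
    proof
      assume "z \<in> range p"
      then obtain j where j: "z = p j" by blast
      show False
      proof (cases "j \<le> i")
        case True then show ?thesis using mono[of j i] j that by (cases "j = i") auto
      next
        case False then show ?thesis using mono[of "i + 1" j] j that by (cases "j = i + 1") auto
      qed
    qed
    then have "site (p i + 1) \<notin> X" "site (p i + 2) \<notin> X"
      using range[of "p i + 1"] range[of "p i + 2"] gap[of "p i + 1"] gap[of "p i + 2"] a by linarith+
    moreover have "wrap Ns (site (p i + 1) + 1) = site (p i + 2)"
      using wrap_site[of "p i + 1" 1] by (simp add: add.assoc)
    ultimately show False using dense[OF site_range, of "p i + 1"] by simp
  qed
  have lift: "lift p" unfolding lift_def using per inc le2 by (simp add: zless_iff_Suc_zadd[symmetric] add1_zle_eq)
  define w where "w k = snd (the_inv_into S fst (xs ! k))" for k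
  have inj: "inj_on fst S" using S by (simp add: spin_configs_def)
  have "labelled (pos p) w = S"
  proof -
    have el: "(pos p k, w k) = the_inv_into S fst (xs ! k)" if "k < Ne" for k
    proof -
      have "xs ! k \<in> fst ` S" using nth_mem[of k xs] that by (simp add: xs(1,2) flip: X_def)
      then have "fst (the_inv_into S fst (xs ! k)) = xs ! k" using inj by (rule f_the_inv_into_f[rotated])
      then show ?thesis using that by (auto simp: site_p w_def prod_eq_iff)
    qed
    have "labelled (pos p) w = the_inv_into S fst ` ((!) xs ` {..<Ne})"
      unfolding labelled_def image_image using el by (intro image_cong) auto
    also have "(!) xs ` {..<Ne} = fst ` S"
      using xs(1,2) by (auto simp: set_conv_nth simp flip: X_def)
    also have "the_inv_into S fst ` (fst ` S) = S" using inj by (simp add: the_inv_into_onto)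
    finally show ?thesis .
  qed
  then show ?thesis using lift by blast
qed

definition ups :: "mode set \<Rightarrow> nat" where
  "ups S = card {m \<in> S. snd m}"

lemma ups_labelled:
  assumes "inj_on g {..<Ne}" shows "ups (labelled g w) = card {k. k < Ne \<and> w k}"
proof -
  have "{m \<in> labelled g w. snd m} = (\<lambda>k. (g k, w k)) ` {k. k < Ne \<and> w k}"
    by (auto simp: labelled_def)
  moreover have "inj_on (\<lambda>k. (g k, w k)) {k. k < Ne \<and> w k}"
    using assms by (auto simp: inj_on_def)
  ultimately show ?thesis unfolding ups_def by (simp only: card_image)
qed

text \<open>Spins are rearranged at fixed positions, then the electrons are transported with their
  spin sequence fixed.\<close>

theorem hop_connected:
  assumes "S \<in> spin_configs" "S' \<in> spin_configs" "ups S = ups S'"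
  shows "hop_step\<^sup>*\<^sup>* S S'"
proof -
  obtain p w p' w' where S: "lift p" "S = labelled (pos p) w" and S': "lift p'" "S' = labelled (pos p') w'"
    using spin_configs_labelled assms by metis
  have "card {k. k < Ne \<and> w k} = card {k. k < Ne \<and> w' k}"
    using assms(3) S S' by (simp add: ups_labelled inj_on_pos)
  then show ?thesis unfolding S(2) S'(2)
    by (rule rtranclp_trans[OF spins_connected[OF S(1)] lift_connected[OF S(1) S'(1)]])
qed

end

section \<open>The effective Hamiltonian on the restricted space\<close>

interpretation fock: vector_space cscale
  by unfold_locales (auto simp: cscale_def fun_eq_iff algebra_simps)

lemma sum_fun_at: "(\<Sum>a\<in>A. f a) x = (\<Sum>a\<in>A. f a x)"
  by (induction A rule: infinite_finite_induct) auto

section \<open>The N-electron space in the occupation basis\<close>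

definition basis_state :: "mode set \<Rightarrow> fock" where
  "basis_state S = (\<lambda>T. of_bool (T = S))"

lemma jw_sign_cases: "jw_sign m S = 1 \<or> jw_sign m S = -1"
  unfolding jw_sign_def by (cases "even (card {m' \<in> S. mode_idx m' < mode_idx m})") auto

lemma foldr_cre_support:
  "foldr cre ms vac S \<noteq> 0 \<Longrightarrow> S \<subseteq> set ms \<and> finite S \<and> card S = length ms"
proof (induction ms arbitrary: S)
  case Nil then show ?case by (simp add: vac_def split: if_splits)
next
  case (Cons m ms)
  then have m: "m \<in> S" and "foldr cre ms vac (S - {m}) \<noteq> 0"
    by (auto simp: cre_def[of m] split: if_splits)
  with Cons.IH have *: "S - {m} \<subseteq> set ms" "finite (S - {m})" "card (S - {m}) = length ms" by blast+
  then have "finite S" by simp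
  then show ?case using m * card_Suc_Diff1[of S m] by auto
qed

lemma basis_state_foldr_cre:
  "finite S \<Longrightarrow> \<exists>ms c. length ms = card S \<and> set ms = S \<and> c \<noteq> 0 \<and> foldr cre ms vac = cscale c (basis_state S)"
proof (induction S rule: finite_induct)
  case empty
  show ?case by (intro exI[of _ "[]"] exI[of _ 1]) (auto simp: vac_def cscale_def basis_state_def)
next
  case (insert m S)
  then obtain ms c where ms: "length ms = card S" "set ms = S" "c \<noteq> 0" "foldr cre ms vac = cscale c (basis_state S)"
    by blast
  have "cre m (cscale c (basis_state S)) = cscale (jw_sign m (insert m S) * c) (basis_state (insert m S))"
  proof
    fix T
    have "m \<in> T \<and> T - {m} = S \<longleftrightarrow> T = insert m S" using insert.hyps(2) by auto
    then show "cre m (cscale c (basis_state S)) T = cscale (jw_sign m (insert m S) * c) (basis_state (insert m S)) T"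
      by (auto simp: cre_def cscale_def basis_state_def)
  qed
  then show ?case using ms insert.hyps jw_sign_cases[of m "insert m S"]
    by (intro exI[of _ "m # ms"] exI[of _ "jw_sign m (insert m S) * c"]) auto
qed

text \<open>A product of creation operators is supported on sets with as many modes as it has
  factors, and vanishes if a mode repeats. Conversely each basis state is a nonzero multiple of such
  a product.\<close>

lemma H_N_eq: "H_N Ns Ne = {\<psi>. \<forall>S. \<psi> S \<noteq> 0 \<longrightarrow> S \<subseteq> {1..Ns} \<times> UNIV \<and> card S = Ne}" (is "_ = ?V")
proof
  let ?G = "{foldr cre ms vac | ms. length ms = Ne \<and> (\<forall>m\<in>set ms. fst m \<in> {1..Ns})}"
  have "fock.subspace ?V"
  proof (rule fock.subspaceI)
    show "x + y \<in> ?V" if "x \<in> ?V" "y \<in> ?V" for x y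
    proof (intro CollectI allI impI)
      fix S assume "(x + y) S \<noteq> 0"
      then have "x S \<noteq> 0 \<or> y S \<noteq> 0" by auto
      then show "S \<subseteq> {1..Ns} \<times> UNIV \<and> card S = Ne" using that by blast
    qed
    show "cscale c x \<in> ?V" if "x \<in> ?V" for c x
      using that unfolding mem_Collect_eq cscale_def mult_eq_0_iff by blast
  qed simp
  moreover have "?G \<subseteq> ?V" using foldr_cre_support by fastforce
  ultimately show "H_N Ns Ne \<subseteq> ?V" unfolding H_N_def by (intro fock.span_minimal)
  show "?V \<subseteq> H_N Ns Ne"
  proof
    fix \<psi> assume \<psi>: "\<psi> \<in> ?V"
    let ?B = "{S. S \<subseteq> {1..Ns} \<times> (UNIV :: bool set) \<and> card S = Ne}"
    have fin: "finite ?B" by (rule finite_subset[of _ "Pow ({1..Ns} \<times> UNIV)"]) auto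
    have "\<psi> = (\<Sum>S\<in>?B. cscale (\<psi> S) (basis_state S))"
    proof
      fix T
      have "(\<Sum>S\<in>?B. cscale (\<psi> S) (basis_state S)) T = (\<Sum>S\<in>?B. if T = S then \<psi> S else 0)"
        unfolding sum_fun_at by (intro sum.cong) (auto simp: cscale_def basis_state_def)
      also have "\<dots> = \<psi> T" using \<psi> fin by (auto simp: sum.delta' eq_commute[of T])
      finally show "\<psi> T = (\<Sum>S\<in>?B. cscale (\<psi> S) (basis_state S)) T" by simp
    qed
    moreover have "basis_state S \<in> H_N Ns Ne" if S: "S \<in> ?B" for S
    proof -
      have "finite S" using S finite_subset by fastforce
      then obtain ms c where ms: "length ms = card S" "set ms = S" "c \<noteq> 0" "foldr cre ms vac = cscale c (basis_state S)"
        using basis_state_foldr_cre by blast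
      then have "cscale c (basis_state S) \<in> ?G" using S by (intro CollectI exI[of _ ms]) auto
      then have "cscale (1 / c) (cscale c (basis_state S)) \<in> H_N Ns Ne"
        unfolding H_N_def by (intro fock.span_scale fock.span_base)
      then show ?thesis using ms(3) by simp
    qed
    ultimately show "\<psi> \<in> H_N Ns Ne" unfolding H_N_def
      by (metis (no_types, lifting) fock.span_scale fock.span_sum)
  qed
qed

context isolated_holes begin

section \<open>The allowed configurations\<close>

lemma wrap_Suc: "1 \<le> x \<Longrightarrow> x \<le> Ns \<Longrightarrow> wrap Ns (Suc x) = (if x = Ns then 1 else Suc x)"
  by (auto simp: wrap_def)

lemma wrap_Suc_Suc:
  assumes x: "1 \<le> x" "x \<le> Ns" "even x"
  shows "wrap Ns (Suc (Suc x)) = (if x = Ns then 2 else Suc (Suc x))"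
proof (cases "x = Ns")
  case True then show ?thesis using Ns_ge by (simp add: wrap_def mod_Suc)
next
  case False
  then have "Suc (Suc x) \<le> Ns" using x even_Ns by (auto elim!: evenE)
  then show ?thesis using False by (simp add: wrap_def)
qed

lemma bij_wrap_Suc: "bij_betw (\<lambda>x. wrap Ns (x + 1)) {1..Ns} {1..Ns}"
proof -
  have "inj_on (\<lambda>x. wrap Ns (x + 1)) {1..Ns}"
  proof (rule inj_onI)
    fix x y assume "x \<in> {1..Ns}" "y \<in> {1..Ns}" "wrap Ns (x + 1) = wrap Ns (y + 1)"
    then show "x = y" using wrap_Suc[of x] wrap_Suc[of y] by (cases "x = Ns"; cases "y = Ns") simp_all
  qed
  moreover have "(\<lambda>x. wrap Ns (x + 1)) ` {1..Ns} \<subseteq> {1..Ns}" using wrap_range by blast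
  ultimately show ?thesis by (simp add: bij_betw_def endo_inj_surj)
qed

lemma occ_inj:
  assumes "inj_on fst S" shows "occ S x = of_bool (x \<in> fst ` S)"
proof (cases "x \<in> fst ` S")
  case True
  then obtain \<sigma> where "(x, \<sigma>) \<in> S" by auto
  moreover have "\<sigma>' = \<sigma>" if "(x, \<sigma>') \<in> S" for \<sigma>'
    using inj_onD[OF assms, of "(x, \<sigma>')" "(x, \<sigma>)"] that \<open>(x, \<sigma>) \<in> S\<close> by simp
  ultimately have "{\<sigma>. (x, \<sigma>) \<in> S} = {\<sigma>}" by blast
  then show ?thesis using True by (simp add: occ_def)
next
  case False
  then have "{\<sigma>. (x, \<sigma>) \<in> S} = {}" by force
  then show ?thesis using False by (simp add: occ_def)
qed

text \<open>The number of adjacent pairs of holes, the sum of (1 - n_x)(1 - n_{x+1}), equals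
  \<open>Ns\<close> - 2 \<open>Ne\<close> plus the neighbour sum. It vanishes exactly when each of
  its nonnegative terms does.\<close>

lemma neighbour_sum_iff:
  assumes X: "X \<subseteq> {1..Ns}" "card X = Ne"
  shows "int (\<Sum>x\<in>{1..Ns}. of_bool (x \<in> X) * of_bool (wrap Ns (x + 1) \<in> X)) = 2 * int Ne - int Ns
    \<longleftrightarrow> (\<forall>x\<in>{1..Ns}. x \<in> X \<or> wrap Ns (x + 1) \<in> X)"
proof -
  define o1 where "o1 x = (of_bool (x \<in> X) :: int)" for x
  have s1: "(\<Sum>x\<in>{1..Ns}. o1 x) = int Ne"
    using X by (simp add: o1_def of_bool_def sum.If_cases Int_absorb1)
  have s2: "(\<Sum>x\<in>{1..Ns}. o1 (wrap Ns (x + 1))) = int Ne"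
    using sum.reindex_bij_betw[OF bij_wrap_Suc, of o1] s1 by simp
  have "(\<Sum>x\<in>{1..Ns}. (1 - o1 x) * (1 - o1 (wrap Ns (x + 1)))) =
     (\<Sum>x\<in>{1..Ns}. 1 - o1 x - o1 (wrap Ns (x + 1)) + o1 x * o1 (wrap Ns (x + 1)))"
    by (intro sum.cong) (auto simp: algebra_simps)
  also have "\<dots> = int Ns - 2 * int Ne + (\<Sum>x\<in>{1..Ns}. o1 x * o1 (wrap Ns (x + 1)))"
    by (simp only: sum.distrib sum_subtractf s1 s2) simp
  finally have *: "(\<Sum>x\<in>{1..Ns}. (1 - o1 x) * (1 - o1 (wrap Ns (x + 1)))) = \<dots>" .
  have "(\<Sum>x\<in>{1..Ns}. (1 - o1 x) * (1 - o1 (wrap Ns (x + 1)))) = 0 \<longleftrightarrow>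
      (\<forall>x\<in>{1..Ns}. (1 - o1 x) * (1 - o1 (wrap Ns (x + 1))) = 0)"
    by (intro sum_nonneg_eq_0_iff) (auto simp: o1_def)
  also have "\<dots> \<longleftrightarrow> (\<forall>x\<in>{1..Ns}. x \<in> X \<or> wrap Ns (x + 1) \<in> X)"
    by (auto simp: o1_def)
  finally have **: "(\<Sum>x\<in>{1..Ns}. (1 - o1 x) * (1 - o1 (wrap Ns (x + 1)))) = 0 \<longleftrightarrow>
      (\<forall>x\<in>{1..Ns}. x \<in> X \<or> wrap Ns (x + 1) \<in> X)" .
  have "int (\<Sum>x\<in>{1..Ns}. of_bool (x \<in> X) * of_bool (wrap Ns (x + 1) \<in> X)) =
     (\<Sum>x\<in>{1..Ns}. o1 x * o1 (wrap Ns (x + 1)))"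
    unfolding of_nat_sum o1_def of_nat_mult of_nat_of_bool ..
  then show ?thesis using * ** by linarith
qed

lemma spin_configs_iff:
  "S \<in> spin_configs \<longleftrightarrow> S \<subseteq> {1..Ns} \<times> UNIV \<and> card S = Ne \<and> allowed Ns Ne S"
proof
  assume S: "S \<in> spin_configs"
  then have inj: "inj_on fst S" and C: "fst ` S \<in> site_configs" by (auto simp: spin_configs_def)
  then have X: "fst ` S \<subseteq> {1..Ns}" "card (fst ` S) = Ne" by (auto simp: site_configs_def)
  have "card S = Ne" using X card_image[OF inj] by simp
  moreover have "S \<subseteq> {1..Ns} \<times> UNIV" using X by (auto simp: mem_Times_iff)
  moreover have "allowed Ns Ne S" unfolding allowed_def occ_inj[OF inj]
    using neighbour_sum_iff[OF X] C by (auto simp: site_configs_def)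
  ultimately show "S \<subseteq> {1..Ns} \<times> UNIV \<and> card S = Ne \<and> allowed Ns Ne S" by blast
next
  assume S: "S \<subseteq> {1..Ns} \<times> UNIV \<and> card S = Ne \<and> allowed Ns Ne S"
  have inj: "inj_on fst S"
  proof (rule inj_onI)
    fix a b assume ab: "a \<in> S" "b \<in> S" "fst a = fst b"
    show "a = b"
    proof (rule ccontr)
      assume "a \<noteq> b"
      then have "snd a \<noteq> snd b" using ab by (auto simp: prod_eq_iff)
      then have "UNIV = {snd a, snd b}" by (auto simp: UNIV_bool)
      moreover have "{\<sigma>. (fst a, \<sigma>) \<in> S} \<supseteq> {snd a, snd b}" using ab by auto (metis prod.collapse)+
      ultimately have "{\<sigma>. (fst a, \<sigma>) \<in> S} = UNIV" by blast
      then have "occ S (fst a) = 2" by (simp add: occ_def)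
      moreover have "fst a \<in> {1..Ns}" using S ab by (auto simp: mem_Times_iff)
      ultimately show False using S unfolding allowed_def by (metis numeral_le_one_iff semiring_norm(69))
    qed
  qed
  have X: "fst ` S \<subseteq> {1..Ns}" "card (fst ` S) = Ne" using S card_image[OF inj] by auto
  moreover have "\<forall>x\<in>{1..Ns}. x \<in> fst ` S \<or> wrap Ns (x + 1) \<in> fst ` S"
    using S neighbour_sum_iff[OF X] by (auto simp: allowed_def occ_inj[OF inj])
  ultimately show "S \<in> spin_configs" using inj by (simp add: spin_configs_def site_configs_def)
qed

lemma restricted_space_eq: "restricted_space Ns Ne = {\<psi>. \<forall>S. S \<notin> spin_configs \<longrightarrow> \<psi> S = 0}"
proof (intro equalityI subsetI)
  fix \<psi> :: fock assume "\<psi> \<in> {\<psi>. \<forall>S. S \<notin> spin_configs \<longrightarrow> \<psi> S = 0}"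
  then have "\<psi> \<in> H_N Ns Ne" "proj Ns Ne \<psi> = \<psi>"
    by (auto simp: H_N_eq proj_def spin_configs_iff fun_eq_iff)
  then show "\<psi> \<in> restricted_space Ns Ne" unfolding restricted_space_def by (metis imageI)
next
  fix \<psi> assume "\<psi> \<in> restricted_space Ns Ne"
  then obtain \<phi> where "\<psi> = proj Ns Ne \<phi>" "\<phi> \<in> H_N Ns Ne" by (auto simp: restricted_space_def)
  then show "\<psi> \<in> {\<psi>. \<forall>S. S \<notin> spin_configs \<longrightarrow> \<psi> S = 0}"
    unfolding H_N_eq spin_configs_iff proj_def mem_Collect_eq by metis
qed

lemma finite_site_configs: "finite site_configs"
  by (rule finite_subset[of _ "Pow {1..Ns}"]) (auto simp: site_configs_def)

lemma finite_spin_configs: "finite spin_configs"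
  by (rule finite_subset[of _ "Pow ({1..Ns} \<times> UNIV)"]) (use spin_configs_iff in blast, simp)

lemma fst_hop:
  assumes "inj_on fst S" "(x, \<sigma>) \<in> S"
  shows "fst ` insert (y, \<sigma>) (S - {(x, \<sigma>)}) = insert y (fst ` S - {x})"
proof -
  have "fst ` (S - {(x, \<sigma>)}) = fst ` S - {x}"
    using inj_on_image_set_diff[OF assms(1), of S "{(x, \<sigma>)}"] assms(2) by simp
  then show ?thesis by simp
qed

text \<open>The admissibility of a hop is expressed by occupied sites alone; this is what decouples
  the amplitudes from the spins.\<close>

lemma hop_spin_configs_iff:
  assumes S: "S \<in> spin_configs" and x: "(x, \<sigma>) \<in> S" and y: "(y, \<sigma>) \<notin> S"
  shows "insert (y, \<sigma>) (S - {(x, \<sigma>)}) \<in> spin_configs \<longleftrightarrow>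
    y \<notin> fst ` S \<and> insert y (fst ` S - {x}) \<in> site_configs"
proof -
  have inj: "inj_on fst S" using S by (simp add: spin_configs_def)
  have "x \<noteq> y" using x y by auto
  have "inj_on fst (insert (y, \<sigma>) (S - {(x, \<sigma>)})) \<longleftrightarrow> y \<notin> fst ` S"
  proof
    assume *: "inj_on fst (insert (y, \<sigma>) (S - {(x, \<sigma>)}))"
    show "y \<notin> fst ` S"
    proof
      assume "y \<in> fst ` S"
      then obtain \<sigma>' where "(y, \<sigma>') \<in> S" by auto
      then show False using * y \<open>x \<noteq> y\<close> by (metis Diff_iff fst_conv inj_onD insert_iff prod.inject singletonD)
    qed
  next
    assume "y \<notin> fst ` S"
    then show "inj_on fst (insert (y, \<sigma>) (S - {(x, \<sigma>)}))"
      using inj by (auto simp: inj_on_diff)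
  qed
  then show ?thesis by (simp only: spin_configs_def mem_Collect_eq fst_hop[OF inj x])
qed

section \<open>Signs of the hopping terms\<close>

text \<open>\<open>mode_idx\<close> orders modes by site first, so spin matters only at
  \<open>x\<close> itself, and the second assumption excludes the other mode there.\<close>

lemma jw_sign_inj:
  assumes "inj_on fst S" "(x, \<not> \<sigma>) \<notin> S"
  shows "jw_sign (x, \<sigma>) S = (-1) ^ card {z \<in> fst ` S. z < x}"
proof -
  have "{z \<in> fst ` S. z < x} = fst ` {m' \<in> S. mode_idx m' < mode_idx (x, \<sigma>)}"
  proof -
    have "mode_idx m' < mode_idx (x, \<sigma>) \<longleftrightarrow> fst m' < x" if "m' \<in> S" for m'
    proof (cases "fst m' = x")
      case True
      then have "m' = (x, \<sigma>)" using that assms(2) by (cases m'; cases \<sigma>; cases "snd m'") auto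
      then show ?thesis by simp
    next
      case False
      then show ?thesis by (auto simp: mode_idx_def)
    qed
    then show ?thesis by auto
  qed
  moreover have "inj_on fst {m' \<in> S. mode_idx m' < mode_idx (x, \<sigma>)}"
    using assms(1) by (rule inj_on_subset) auto
  ultimately show ?thesis by (simp add: jw_sign_def card_image)
qed

text \<open>As functions of the final configuration, the operators read the amplitude of the initial
  one: the electron is at \<open>x\<close> in \<open>S\<close> and at \<open>y\<close> in the
  argument of \<psi>. \<open>par\<close> asks that the sign be the same for all
  configurations.\<close>

lemma cre_ann_hop:
  assumes \<psi>: "\<And>S. S \<notin> spin_configs \<Longrightarrow> \<psi> S = 0" and S: "S \<in> spin_configs" and "x \<noteq> y"
    and par: "\<And>X. X \<in> site_configs \<Longrightarrow> x \<in> X \<Longrightarrow> y \<notin> X \<Longrightarrow>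
      (-1) ^ (card {z \<in> X. z < x} + card {z \<in> X - {x}. z < y}) = (s::complex)"
  shows "cre (x, \<sigma>) (ann (y, \<sigma>) \<psi>) S =
    s * (if (x, \<sigma>) \<in> S \<and> (y, \<sigma>) \<notin> S then \<psi> (insert (y, \<sigma>) (S - {(x, \<sigma>)})) else 0)"
proof (cases "(x, \<sigma>) \<in> S \<and> (y, \<sigma>) \<notin> S \<and> insert (y, \<sigma>) (S - {(x, \<sigma>)}) \<in> spin_configs")
  case True
  have inj: "inj_on fst S" and X: "fst ` S \<in> site_configs" using S by (simp_all add: spin_configs_def)
  have y: "y \<notin> fst ` S" using hop_spin_configs_iff[OF S] True by blast
  have "(x, \<not> \<sigma>) \<notin> S" using True inj by (metis fst_conv inj_onD prod.inject)
  then have 1: "jw_sign (x, \<sigma>) S = (-1) ^ card {z \<in> fst ` S. z < x}" by (rule jw_sign_inj[OF inj])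
  have "fst ` (S - {(x, \<sigma>)}) = fst ` S - {x}"
    using inj_on_image_set_diff[OF inj, of S "{(x, \<sigma>)}"] True by simp
  moreover have "(y, \<not> \<sigma>) \<notin> S - {(x, \<sigma>)}" using y by force
  ultimately have 2: "jw_sign (y, \<sigma>) (S - {(x, \<sigma>)}) = (-1) ^ card {z \<in> fst ` S - {x}. z < y}"
    using jw_sign_inj[OF inj_on_diff[OF inj], of y \<sigma>] by simp
  have "x \<in> fst ` S" using True by force
  then have "jw_sign (x, \<sigma>) S * jw_sign (y, \<sigma>) (S - {(x, \<sigma>)}) = s"
    unfolding 1 2 using par[OF X _ y] by (simp add: power_add)
  then show ?thesis using True \<open>x \<noteq> y\<close> by (simp add: cre_def ann_def mult.assoc[symmetric])
next
  case False
  then show ?thesis using \<open>x \<noteq> y\<close> \<psi> by (auto simp: cre_def ann_def)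
qed

lemma card_others:
  assumes "X \<in> site_configs" "x \<in> X" shows "even (card (X - {x}))"
  using assms odd_Ne by (auto simp: site_configs_def)

text \<open>A hop across the boundary passes the remaining Ne - 1 electrons, an even number.\<close>

lemma parity_neighbour:
  assumes X: "X \<in> site_configs" "x \<in> X" "y \<notin> X" and r: "x \<in> {1..Ns}" "y \<in> {1..Ns}"
    and "y = wrap Ns (x + 1) \<or> x = wrap Ns (y + 1)"
  shows "(-1) ^ (card {z \<in> X. z < x} + card {z \<in> X - {x}. z < y}) = (1::complex)"
proof -
  have XN: "X \<subseteq> {1..Ns}" using X by (auto simp: site_configs_def)
  consider "y = x + 1" | "x = y + 1" | "x = Ns" "y = 1" | "x = 1" "y = Ns"
    using assms(6) r by (auto simp: wrap_Suc split: if_splits)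
  then have "even (card {z \<in> X. z < x} + card {z \<in> X - {x}. z < y})"
  proof cases
    case 1
    then have "{z \<in> X - {x}. z < y} = {z \<in> X. z < x}" by auto
    then show ?thesis by simp
  next
    case 2
    have "{z \<in> X - {x}. z < y} = {z \<in> X. z < x}"
      using 2 X(3) by (auto simp: less_Suc_eq)
    then show ?thesis by simp
  next
    case 3
    have "{z \<in> X. z < x} = X - {x}" "{z \<in> X - {x}. z < y} = {}" using 3 XN by (auto simp: le_neq_implies_less)
    then show ?thesis using card_others[OF X(1,2)] by (simp only: card.empty) simp
  next
    case 4
    have "{z \<in> X. z < x} = {}" using 4 XN by auto
    moreover have "{z \<in> X - {x}. z < y} = X - {x}"
      using 4 XN X(3) by (auto simp: le_neq_implies_less) (metis XN atLeastAtMost_iff le_neq_implies_less subsetD)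
    ultimately show ?thesis using card_others[OF X(1,2)] by (simp only: card.empty) simp
  qed
  then show ?thesis by simp
qed

text \<open>The site jumped over is occupied because the target is a hole, which flips the sign.\<close>

lemma parity_next_neighbour:
  assumes X: "X \<in> site_configs" "x \<in> X" "y \<notin> X" and r: "x \<in> {1..Ns}" "y \<in> {1..Ns}"
    and "even x \<and> y = wrap Ns (x + 2) \<or> even y \<and> x = wrap Ns (y + 2)"
  shows "(-1) ^ (card {z \<in> X. z < x} + card {z \<in> X - {x}. z < y}) = (-1::complex)"
proof -
  have XN: "X \<subseteq> {1..Ns}" and dense: "\<And>z. z \<in> {1..Ns} \<Longrightarrow> z \<in> X \<or> wrap Ns (z + 1) \<in> X"
    using X by (auto simp: site_configs_def)
  have fin: "finite {z \<in> X. P z}" for P using XN finite_subset by fastforce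
  consider "y = x + 2" | "x = y + 2" | "x = Ns" "y = 2" | "x = 2" "y = Ns"
    using assms(6) r by (auto simp: wrap_Suc_Suc split: if_splits)
  then have "odd (card {z \<in> X. z < x} + card {z \<in> X - {x}. z < y})"
  proof cases
    case 1
    then have "x + 1 \<in> X" using dense[of "x + 1"] X(3) r by (auto simp: wrap_Suc split: if_splits)
    then have "{z \<in> X - {x}. z < y} = insert (x + 1) {z \<in> X. z < x}" using 1 by auto
    then show ?thesis using fin by simp
  next
    case 2
    then have "y + 1 \<in> X" using dense[of y] X(3) r by (auto simp: wrap_Suc split: if_splits)
    then have "{z \<in> X. z < x} = insert (y + 1) {z \<in> X - {x}. z < y}"
      using 2 X(3) by (auto simp: less_Suc_eq)
    moreover have "finite {z \<in> X - {x}. z < y}" by (rule finite_subset[OF _ fin[of "\<lambda>_. True"]]) auto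
    ultimately show ?thesis by simp
  next
    case 3
    have "1 \<in> X" using dense[of 1] X(3) r 3 Ns_ge wrap_Suc[of 1]
      by (auto simp: numeral_2_eq_2 split: if_splits)
    \<comment> \<open>Across the boundary one count is that of all other electrons, which is even,
      and the other consists of the electron on site 1 alone.\<close>
    then have "{z \<in> X. z < x} = X - {x}" "{z \<in> X - {x}. z < y} = {1}"
      using 3 XN Ns_ge by (auto simp: le_neq_implies_less)
    then show ?thesis using card_others[OF X(1,2)] by simp
  next
    case 4
    have "1 \<in> X" using dense[of Ns] X(3) r 4 Ns_ge by (auto simp: wrap_Suc split: if_splits)
    then have "{z \<in> X. z < x} = {1}" using 4 XN by auto
    moreover have "{z \<in> X - {x}. z < y} = X - {x}"
      using 4 XN X(3) by (auto simp: le_neq_implies_less) (metis XN atLeastAtMost_iff le_neq_implies_less subsetD)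
    ultimately show ?thesis using card_others[OF X(1,2)] by simp
  qed
  then show ?thesis by simp
qed

definition hop_sum :: "fock \<Rightarrow> mode set \<Rightarrow> nat \<Rightarrow> nat \<Rightarrow> complex" where
  "hop_sum \<psi> S x y = (\<Sum>\<sigma>\<in>UNIV. if (x, \<sigma>) \<in> S \<and> (y, \<sigma>) \<notin> S then \<psi> (insert (y, \<sigma>) (S - {(x, \<sigma>)})) else 0)"

lemma hop_amp_sum:
  fixes h :: "nat \<Rightarrow> nat \<Rightarrow> complex"
  shows "(\<Sum>x\<in>{1..Ns}. \<Sum>y\<in>{1..Ns}. of_real (hop_amp x y) * h x y) =
     of_real t * (\<Sum>x\<in>{1..Ns}. h x (wrap Ns (x + 1)) + h (wrap Ns (x + 1)) x) +
     of_real t' * (\<Sum>j\<in>{1..Ns div 2}. h (2 * j) (wrap Ns (2 * j + 2)) + h (wrap Ns (2 * j + 2)) (2 * j))"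
proof -
  have of_bool_real: "of_real (of_bool P) = (of_bool P :: complex)" for P by simp
  have delta: "(\<Sum>y\<in>{1..Ns}. of_bool (y = wrap Ns z) * k y) = k (wrap Ns z)" for z and k :: "nat \<Rightarrow> complex"
    using wrap_range[of z] by (simp add: of_bool_def if_distrib[of "\<lambda>a. a * _"] cong: if_cong)
  have ev: "(\<Sum>x\<in>{1..Ns}. of_bool (even x) * k x) = (\<Sum>j\<in>{1..Ns div 2}. k (2 * j))" for k :: "nat \<Rightarrow> complex"
  proof -
    have "(\<Sum>x\<in>{1..Ns}. of_bool (even x) * k x) = (\<Sum>x\<in>{x\<in>{1..Ns}. even x}. k x)"
      by (subst sum.inter_filter) (simp_all add: of_bool_def if_distrib[of "\<lambda>a. a * _"] cong: if_cong)
    also have "{x\<in>{1..Ns}. even x} = (\<lambda>j. 2 * j) ` {1..Ns div 2}" by (auto elim!: evenE)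
    finally show ?thesis by (simp add: sum.reindex inj_on_def)
  qed
  have 1: "(\<Sum>x\<in>{1..Ns}. \<Sum>y\<in>{1..Ns}. of_bool (y = wrap Ns (x + 1)) * h x y) = (\<Sum>x\<in>{1..Ns}. h x (wrap Ns (x + 1)))"
    by (simp only: delta)
  have 2: "(\<Sum>x\<in>{1..Ns}. \<Sum>y\<in>{1..Ns}. of_bool (x = wrap Ns (y + 1)) * h x y) = (\<Sum>x\<in>{1..Ns}. h (wrap Ns (x + 1)) x)"
    by (subst sum.swap) (simp only: delta)
  have 3: "(\<Sum>x\<in>{1..Ns}. \<Sum>y\<in>{1..Ns}. of_bool (even x \<and> y = wrap Ns (x + 2)) * h x y) = (\<Sum>j\<in>{1..Ns div 2}. h (2 * j) (wrap Ns (2 * j + 2)))"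
    unfolding of_bool_conj mult.assoc by (simp only: delta ev flip: sum_distrib_left)
  have 4: "(\<Sum>x\<in>{1..Ns}. \<Sum>y\<in>{1..Ns}. of_bool (even y \<and> x = wrap Ns (y + 2)) * h x y) = (\<Sum>j\<in>{1..Ns div 2}. h (wrap Ns (2 * j + 2)) (2 * j))"
    unfolding of_bool_conj mult.assoc by (subst sum.swap) (simp only: delta ev flip: sum_distrib_left)
  have "(\<Sum>x\<in>{1..Ns}. \<Sum>y\<in>{1..Ns}. of_real (hop_amp x y) * h x y) =
    (\<Sum>x\<in>{1..Ns}. \<Sum>y\<in>{1..Ns}. of_real t * (of_bool (y = wrap Ns (x + 1)) * h x y) + of_real t * (of_bool (x = wrap Ns (y + 1)) * h x y)
     + of_real t' * (of_bool (even x \<and> y = wrap Ns (x + 2)) * h x y) + of_real t' * (of_bool (even y \<and> x = wrap Ns (y + 2)) * h x y))"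
    unfolding hop_amp_def of_real_add of_real_mult of_bool_real distrib_left distrib_right mult.assoc add.assoc ..
  also have "\<dots> = of_real t * (\<Sum>x\<in>{1..Ns}. h x (wrap Ns (x + 1))) + of_real t * (\<Sum>x\<in>{1..Ns}. h (wrap Ns (x + 1)) x)
    + of_real t' * (\<Sum>j\<in>{1..Ns div 2}. h (2 * j) (wrap Ns (2 * j + 2))) + of_real t' * (\<Sum>j\<in>{1..Ns div 2}. h (wrap Ns (2 * j + 2)) (2 * j))"
    by (simp only: sum.distrib 1 2 3 4 flip: sum_distrib_left)
  finally show ?thesis by (simp only: sum.distrib distrib_left add.assoc)
qed

text \<open>Both bond types acquire the same sign: -t meets parity sign 1 and +t' meets parity sign
  -1.\<close>

lemma H_hop_eq:
  assumes \<psi>: "\<And>S. S \<notin> spin_configs \<Longrightarrow> \<psi> S = 0" and S: "S \<in> spin_configs"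
  shows "H_hop Ns t t' \<psi> S = - (\<Sum>x\<in>{1..Ns}. \<Sum>y\<in>{1..Ns}. of_real (hop_amp x y) * hop_sum \<psi> S x y)"
proof -
  have nn: "(\<Sum>\<sigma>\<in>UNIV. cre (x, \<sigma>) (ann (y, \<sigma>) \<psi>) S) = hop_sum \<psi> S x y"
    if "x \<in> {1..Ns}" "y \<in> {1..Ns}" "y = wrap Ns (x + 1) \<or> x = wrap Ns (y + 1)" for x y
  proof -
    have "x \<noteq> y" using that Ns_ge by (auto simp: wrap_Suc split: if_splits)
    then show ?thesis unfolding hop_sum_def
      using cre_ann_hop[OF \<psi> S _ parity_neighbour[OF _ _ _ that]] by (intro sum.cong) auto
  qed
  have nnn: "(\<Sum>\<sigma>\<in>UNIV. cre (x, \<sigma>) (ann (y, \<sigma>) \<psi>) S) = - hop_sum \<psi> S x y"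
    if "x \<in> {1..Ns}" "y \<in> {1..Ns}" "even x \<and> y = wrap Ns (x + 2) \<or> even y \<and> x = wrap Ns (y + 2)" for x y
  proof -
    have "x \<noteq> y" using that Ns_ge by (auto simp: wrap_Suc_Suc split: if_splits)
    then show ?thesis unfolding hop_sum_def sum_negf[symmetric]
      using cre_ann_hop[OF \<psi> S _ parity_next_neighbour[OF _ _ _ that]] by (intro sum.cong) auto
  qed
  have 1: "(\<Sum>x\<in>{1..Ns}. \<Sum>\<sigma>\<in>UNIV. cre (x,\<sigma>) (ann (wrap Ns (x+1),\<sigma>) \<psi>) S
             + cre (wrap Ns (x+1),\<sigma>) (ann (x,\<sigma>) \<psi>) S) =
        (\<Sum>x\<in>{1..Ns}. hop_sum \<psi> S x (wrap Ns (x + 1)) + hop_sum \<psi> S (wrap Ns (x + 1)) x)"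
    unfolding sum.distrib[of _ _ UNIV] by (intro sum.cong refl arg_cong2[where f = "(+)"] nn) (use wrap_range in auto)
  have 2: "(\<Sum>j\<in>{1..Ns div 2}. \<Sum>\<sigma>\<in>UNIV. cre (2*j,\<sigma>) (ann (wrap Ns (2*j+2),\<sigma>) \<psi>) S
             + cre (wrap Ns (2*j+2),\<sigma>) (ann (2*j,\<sigma>) \<psi>) S) =
        (\<Sum>j\<in>{1..Ns div 2}. - hop_sum \<psi> S (2*j) (wrap Ns (2*j+2)) + - hop_sum \<psi> S (wrap Ns (2*j+2)) (2*j))"
    unfolding sum.distrib[of _ _ UNIV] by (intro sum.cong refl arg_cong2[where f = "(+)"] nnn) (use wrap_range in auto)
  show ?thesis unfolding H_hop_def 1 2 hop_amp_sum
    by (simp only: sum.distrib sum_negf) (simp add: algebra_simps)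
qed

end

section \<open>Signs of on-site spin flips\<close>

text \<open>The two modes of a site are consecutive in the ordering, so the same modes lie below the
  removed and the inserted one, and the signs cancel.\<close>

lemma jw_sign_flip:
  assumes "(x, \<tau>) \<notin> S - {(x, \<sigma>)}"
  shows "jw_sign (x, \<sigma>) S * jw_sign (x, \<tau>) (S - {(x, \<sigma>)}) = 1"
proof -
  have "mode_idx m' < mode_idx (x, \<sigma>) \<longleftrightarrow> m' \<noteq> (x, \<sigma>) \<and> mode_idx m' < mode_idx (x, \<tau>)" if "m' \<in> S" for m'
  proof (cases "fst m' = x")
    case True
    show ?thesis
    proof (cases "m' = (x, \<sigma>)")
      case False
      then have "m' = (x, \<not> \<sigma>)" using True by (cases m') auto
      moreover have "\<tau> = \<sigma>" using assms that \<open>m' = (x, \<not> \<sigma>)\<close> by (cases "\<tau> = \<sigma>") auto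
      ultimately show ?thesis using False by simp
    qed simp
  next
    case False
    then show ?thesis by (auto simp: mode_idx_def)
  qed
  then have "{m' \<in> S. mode_idx m' < mode_idx (x, \<sigma>)} = {m' \<in> S - {(x, \<sigma>)}. mode_idx m' < mode_idx (x, \<tau>)}"
    by auto
  then show ?thesis by (simp add: jw_sign_def flip: power_add)
qed

lemma cre_ann_flip:
  "cre (x, \<sigma>) (ann (x, \<tau>) \<psi>) S =
    (if (x, \<sigma>) \<in> S \<and> (x, \<tau>) \<notin> S - {(x, \<sigma>)} then \<psi> (insert (x, \<tau>) (S - {(x, \<sigma>)})) else 0)"
proof (cases "(x, \<sigma>) \<in> S \<and> (x, \<tau>) \<notin> S - {(x, \<sigma>)}")
  case True
  then have "cre (x, \<sigma>) (ann (x, \<tau>) \<psi>) S =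
      jw_sign (x, \<sigma>) S * jw_sign (x, \<tau>) (S - {(x, \<sigma>)}) * \<psi> (insert (x, \<tau>) (S - {(x, \<sigma>)}))"
    by (simp only: cre_def ann_def if_True simp_thms mult.assoc)
  then show ?thesis using True jw_sign_flip[OF conjunct2[OF True]] by (simp only: if_True mult_1 simp_thms)
next
  case False
  then show ?thesis
    by (cases "(x, \<sigma>) \<in> S") (simp_all only: cre_def ann_def if_True if_False mult_zero_right simp_thms)
qed

context isolated_holes begin

section \<open>Hopping matrices with and without spin\<close>

text \<open>On spin configurations this is the negative of the effective Hamiltonian, as
  \<open>eff_H_eq\<close> shows; the sign turns a lowest eigenvalue into a Perron
  eigenvalue.\<close>

definition hop_matrix :: "mode set \<Rightarrow> mode set \<Rightarrow> real" where
  "hop_matrix S S' = (\<Sum>x\<in>{1..Ns}. \<Sum>y\<in>{1..Ns}. hop_amp x y *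
     (\<Sum>\<sigma>\<in>UNIV. of_bool ((x, \<sigma>) \<in> S \<and> (y, \<sigma>) \<notin> S \<and> S' = insert (y, \<sigma>) (S - {(x, \<sigma>)}))))"

definition site_matrix :: "nat set \<Rightarrow> nat set \<Rightarrow> real" where
  "site_matrix X X' = (\<Sum>x\<in>{1..Ns}. \<Sum>y\<in>{1..Ns}. hop_amp x y *
     of_bool (x \<in> X \<and> y \<notin> X \<and> X' = insert y (X - {x})))"

lemma hop_matrix_sym: "hop_matrix S S' = hop_matrix S' S"
proof -
  have "((x, \<sigma>) \<in> S \<and> (y, \<sigma>) \<notin> S \<and> S' = insert (y, \<sigma>) (S - {(x, \<sigma>)})) \<longleftrightarrow>
     ((y, \<sigma>) \<in> S' \<and> (x, \<sigma>) \<notin> S' \<and> S = insert (x, \<sigma>) (S' - {(y, \<sigma>)}))" for x y and \<sigma> :: bool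
    by (cases "x = y") auto
  then show ?thesis unfolding hop_matrix_def by (subst sum.swap) (simp only: hop_amp_sym)
qed

lemma site_matrix_sym: "site_matrix X X' = site_matrix X' X"
proof -
  have "(x \<in> X \<and> y \<notin> X \<and> X' = insert y (X - {x})) \<longleftrightarrow> (y \<in> X' \<and> x \<notin> X' \<and> X = insert x (X' - {y}))" for x y
    by (cases "x = y") auto
  then show ?thesis unfolding site_matrix_def by (subst sum.swap) (simp only: hop_amp_sym)
qed

lemma hop_matrix_nonneg: "0 \<le> hop_matrix S S'"
  unfolding hop_matrix_def by (intro sum_nonneg mult_nonneg_nonneg hop_amp_nonneg) simp

lemma site_matrix_nonneg: "0 \<le> site_matrix X X'"
  unfolding site_matrix_def by (intro sum_nonneg mult_nonneg_nonneg hop_amp_nonneg) simp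

lemma double_sum_pos:
  fixes h :: "nat \<Rightarrow> nat \<Rightarrow> real"
  assumes "\<And>x y. 0 \<le> h x y" "0 < h a b" "a \<in> A" "b \<in> A" "finite A"
  shows "0 < (\<Sum>x\<in>A. \<Sum>y\<in>A. h x y)"
  using assms by (intro sum_pos2[of A a] sum_pos2[of A b] sum_nonneg) auto

lemma hop_step_pos:
  assumes "hop_step S S'"
  shows "S \<in> spin_configs" "S' \<in> spin_configs" "0 < hop_matrix S S'" "0 < site_matrix (fst ` S) (fst ` S')"
proof -
  obtain x y \<sigma> where S: "S \<in> spin_configs" "S' \<in> spin_configs" and amp: "0 < hop_amp x y"
    and x: "(x, \<sigma>) \<in> S" and y: "(y, \<sigma>) \<notin> S" and S': "S' = insert (y, \<sigma>) (S - {(x, \<sigma>)})"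
    using assms
  proof (cases rule: hop_step.cases)
    case (1 y \<sigma> x)
    then show ?thesis by (intro that[of x y \<sigma>]) simp_all
  qed
  have "(y, \<sigma>) \<in> S'" by (simp add: S')
  then have r: "x \<in> {1..Ns}" "y \<in> {1..Ns}" using S x unfolding spin_configs_iff by blast+
  show "S \<in> spin_configs" "S' \<in> spin_configs" by (fact S)+
  have "0 < (\<Sum>\<sigma>\<in>UNIV. of_bool ((x, \<sigma>) \<in> S \<and> (y, \<sigma>) \<notin> S \<and> S' = insert (y, \<sigma>) (S - {(x, \<sigma>)})) :: real)"
    using x y S' by (intro sum_pos2[of _ \<sigma>]) auto
  then show "0 < hop_matrix S S'" unfolding hop_matrix_def using r amp
    by (intro double_sum_pos[of _ x y] mult_nonneg_nonneg mult_pos_pos sum_nonneg hop_amp_nonneg) simp_all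
  have inj: "inj_on fst S" using S by (simp add: spin_configs_def)
  have "y \<notin> fst ` S" "fst ` S' = insert y (fst ` S - {x})"
    using hop_spin_configs_iff[OF S(1) x y] S(2) fst_hop[OF inj x, of y] unfolding S' by blast+
  moreover have "x \<in> fst ` S" using x by force
  ultimately show "0 < site_matrix (fst ` S) (fst ` S')" unfolding site_matrix_def using r amp
    by (intro double_sum_pos[of _ x y] mult_nonneg_nonneg mult_pos_pos hop_amp_nonneg) simp_all
qed

lemma hop_matrix_apply:
  fixes \<phi> :: fock
  assumes \<phi>: "\<And>S. S \<notin> spin_configs \<Longrightarrow> \<phi> S = 0"
  shows "(\<Sum>S'\<in>spin_configs. of_real (hop_matrix S S') * \<phi> S') =
    (\<Sum>x\<in>{1..Ns}. \<Sum>y\<in>{1..Ns}. of_real (hop_amp x y) * hop_sum \<phi> S x y)"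
proof -
  have of_bool_real: "of_real (of_bool P) = (of_bool P :: complex)" for P by simp
  have delta: "(\<Sum>S'\<in>spin_configs. of_bool (P \<and> S' = T) * \<phi> S') = (if P then \<phi> T else 0)" for P T
  proof -
    have "(\<Sum>S'\<in>spin_configs. of_bool (P \<and> S' = T) * \<phi> S') = (\<Sum>S'\<in>spin_configs. if S' = T then (if P then \<phi> S' else 0) else 0)"
      by (intro sum.cong) auto
    also have "\<dots> = (if P then \<phi> T else 0)"
      using finite_spin_configs \<phi>[of T] by (simp add: sum.delta)
    finally show ?thesis .
  qed
  have "of_real (hop_matrix S S') * \<phi> S' = (\<Sum>x\<in>{1..Ns}. \<Sum>y\<in>{1..Ns}. \<Sum>\<sigma>\<in>UNIV. of_real (hop_amp x y) *
     (of_bool (((x, \<sigma>) \<in> S \<and> (y, \<sigma>) \<notin> S) \<and> S' = insert (y, \<sigma>) (S - {(x, \<sigma>)})) * \<phi> S'))" for S'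
    unfolding hop_matrix_def of_real_sum of_real_mult of_bool_real sum_distrib_left sum_distrib_right mult.assoc conj_assoc ..
  then have "(\<Sum>S'\<in>spin_configs. of_real (hop_matrix S S') * \<phi> S') = (\<Sum>S'\<in>spin_configs. \<Sum>x\<in>{1..Ns}. \<Sum>y\<in>{1..Ns}. \<Sum>\<sigma>\<in>UNIV. of_real (hop_amp x y) *
     (of_bool (((x, \<sigma>) \<in> S \<and> (y, \<sigma>) \<notin> S) \<and> S' = insert (y, \<sigma>) (S - {(x, \<sigma>)})) * \<phi> S'))"
    by simp
  also have "\<dots> = (\<Sum>x\<in>{1..Ns}. \<Sum>y\<in>{1..Ns}. \<Sum>\<sigma>\<in>UNIV. \<Sum>S'\<in>spin_configs. of_real (hop_amp x y) *
     (of_bool (((x, \<sigma>) \<in> S \<and> (y, \<sigma>) \<notin> S) \<and> S' = insert (y, \<sigma>) (S - {(x, \<sigma>)})) * \<phi> S'))"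
    by (simp only: sum.swap[of _ _ spin_configs])
  also have "\<dots> = (\<Sum>x\<in>{1..Ns}. \<Sum>y\<in>{1..Ns}. of_real (hop_amp x y) * hop_sum \<phi> S x y)"
    unfolding hop_sum_def by (simp only: delta flip: sum_distrib_left)
  finally show ?thesis .
qed

lemma eff_H_eq:
  assumes \<psi>: "\<psi> \<in> restricted_space Ns Ne"
  shows "eff_H Ns Ne t t' \<psi> =
    (\<lambda>S. if S \<in> spin_configs then - (\<Sum>S'\<in>spin_configs. of_real (hop_matrix S S') * \<psi> S') else 0)"
proof
  fix S
  have supp: "\<psi> T = 0" if "T \<notin> spin_configs" for T using \<psi> that by (simp add: restricted_space_eq)
  have "proj Ns Ne \<psi> = \<psi>" by (rule ext) (metis proj_def supp spin_configs_iff)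
  then have eff: "eff_H Ns Ne t t' \<psi> S = (if allowed Ns Ne S then H_hop Ns t t' \<psi> S else 0)"
    by (simp add: eff_H_def proj_def)
  show "eff_H Ns Ne t t' \<psi> S = (if S \<in> spin_configs then - (\<Sum>S'\<in>spin_configs. of_real (hop_matrix S S') * \<psi> S') else 0)"
  proof (cases "S \<in> spin_configs")
    case True
    then show ?thesis using eff H_hop_eq[OF supp True] hop_matrix_apply[of \<psi> S, OF supp]
      by (simp add: spin_configs_iff)
  next
    case False
    \<comment> \<open>\<open>allowed\<close> inspects only the sites 1 to \<open>Ns\<close> and does
      not by itself fix the electron number. Hopping terms preserve both the number and the range of
      the modes, so no amplitude reaches an allowed set outside \<open>spin_configs\<close>.\<close>
    have "cre (x, \<sigma>) (ann (y, \<sigma>) \<psi>) S = 0" if al: "allowed Ns Ne S" and x: "x \<in> {1..Ns}" for x y \<sigma>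
    proof (rule ccontr)
      assume nz: "cre (x, \<sigma>) (ann (y, \<sigma>) \<psi>) S \<noteq> 0"
      let ?T = "insert (y, \<sigma>) (S - {(x, \<sigma>)})"
      have xy: "(x, \<sigma>) \<in> S" "(y, \<sigma>) \<notin> S - {(x, \<sigma>)}" and "\<psi> ?T \<noteq> 0"
        using nz by (auto simp: cre_def ann_def split: if_splits)
      then have T: "?T \<subseteq> {1..Ns} \<times> UNIV" "card ?T = Ne" using supp[of ?T] by (auto simp only: spin_configs_iff)
      have "S \<subseteq> {1..Ns} \<times> UNIV"
      proof
        fix m assume "m \<in> S"
        then show "m \<in> {1..Ns} \<times> UNIV" using T(1) x by (cases "m = (x, \<sigma>)") auto
      qed
      moreover have "finite S" using calculation finite_subset by fastforce
      then have "card S = Ne" using T(2) xy card_Suc_Diff1[of S "(x, \<sigma>)"] by simp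
      ultimately show False using False al by (simp add: spin_configs_iff)
    qed
    then have "allowed Ns Ne S \<Longrightarrow> H_hop Ns t t' \<psi> S = 0" unfolding H_hop_def
      using wrap_range by (subst sum.neutral, force) (subst sum.neutral, auto)
    then show ?thesis using eff False by simp
  qed
qed

section \<open>Ferromagnetic states\<close>

definition ferro :: "(nat set \<Rightarrow> real) \<Rightarrow> (nat \<Rightarrow> complex) \<Rightarrow> fock" where
  "ferro f g = (\<lambda>S. if S \<in> spin_configs then of_real (f (fst ` S)) * g (ups S) else 0)"

lemma ferro_restricted: "ferro f g \<in> restricted_space Ns Ne"
  by (simp add: ferro_def restricted_space_eq)

lemma finite_spin_config: "S \<in> spin_configs \<Longrightarrow> finite S"
  by (rule finite_subset[of _ "{1..Ns} \<times> UNIV"]) (use spin_configs_iff in blast, simp)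

lemma ups_hop:
  assumes "finite S" "(x, \<sigma>) \<in> S" "(y, \<sigma>) \<notin> S"
  shows "ups (insert (y, \<sigma>) (S - {(x, \<sigma>)})) = ups S"
proof (cases \<sigma>)
  case True
  let ?U = "{m \<in> S. snd m}"
  have "{m \<in> insert (y, \<sigma>) (S - {(x, \<sigma>)}). snd m} = insert (y, \<sigma>) (?U - {(x, \<sigma>)})"
    using True by auto
  moreover have "finite ?U" "(x, \<sigma>) \<in> ?U" "(y, \<sigma>) \<notin> ?U" using assms True by auto
  ultimately show ?thesis unfolding ups_def using card_Suc_Diff1[of ?U "(x, \<sigma>)"]
    by (simp only: card_insert_disjoint finite_Diff Diff_iff simp_thms)
next
  case False
  then have "{m \<in> insert (y, \<sigma>) (S - {(x, \<sigma>)}). snd m} = {m \<in> S. snd m}" by auto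
  then show ?thesis by (simp add: ups_def)
qed

text \<open>At most one spin is present at \<open>x\<close>, so the spin sum has at most one term; a
  hop onto an occupied site leaves \<open>spin_configs\<close>, where \<open>ferro\<close> is
  0.\<close>

lemma hop_sum_ferro:
  assumes S: "S \<in> spin_configs"
  shows "hop_sum (ferro f g) S x y =
    of_real (of_bool (x \<in> fst ` S \<and> y \<notin> fst ` S \<and> insert y (fst ` S - {x}) \<in> site_configs)
      * f (insert y (fst ` S - {x}))) * g (ups S)"
proof (cases "x \<in> fst ` S")
  case False
  then have "(x, \<sigma>) \<notin> S" for \<sigma> by force
  then show ?thesis using False by (simp add: hop_sum_def)
next
  case True
  then obtain \<sigma> where \<sigma>: "(x, \<sigma>) \<in> S" by auto
  have inj: "inj_on fst S" using S by (simp add: spin_configs_def)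
  have n: "(x, \<not> \<sigma>) \<notin> S" using inj_onD[OF inj, of "(x, \<sigma>)" "(x, \<not> \<sigma>)"] \<sigma> by auto
  let ?T = "insert (y, \<sigma>) (S - {(x, \<sigma>)})"
  have "hop_sum (ferro f g) S x y = (if (y, \<sigma>) \<notin> S then ferro f g ?T else 0)"
    using \<sigma> n by (cases \<sigma>) (simp_all add: hop_sum_def UNIV_bool)
  also have "\<dots> = of_real (of_bool (y \<notin> fst ` S \<and> insert y (fst ` S - {x}) \<in> site_configs)
      * f (insert y (fst ` S - {x}))) * g (ups S)"
  proof (cases "(y, \<sigma>) \<in> S")
    case True
    then have "y \<in> fst ` S" by force
    then show ?thesis using True by simp
  next
    case False
    then show ?thesis
      using hop_spin_configs_iff[OF S \<sigma> False] ups_hop[OF finite_spin_config[OF S] \<sigma> False] fst_hop[OF inj \<sigma>, of y]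
      by (simp add: ferro_def)
  qed
  finally show ?thesis using True by simp
qed

text \<open>The hopping amplitudes do not see the spins, so the amplitude of a ferromagnetic state evolves as
that of spinless particles.\<close>

lemma hop_matrix_ferro:
  assumes S: "S \<in> spin_configs"
  shows "(\<Sum>S'\<in>spin_configs. of_real (hop_matrix S S') * ferro f g S') =
    of_real (\<Sum>X'\<in>site_configs. site_matrix (fst ` S) X' * f X') * g (ups S)"
proof -
  let ?X = "fst ` S"
  have delta: "(\<Sum>X'\<in>site_configs. of_bool (P \<and> X' = Y) * f X') = of_bool (P \<and> Y \<in> site_configs) * f Y" for P Y
  proof -
    have "(\<Sum>X'\<in>site_configs. of_bool (P \<and> X' = Y) * f X') = (\<Sum>X'\<in>site_configs. if X' = Y then (if P then f X' else 0) else 0)"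
      by (intro sum.cong) auto
    also have "\<dots> = of_bool (P \<and> Y \<in> site_configs) * f Y"
      using finite_site_configs by (simp add: sum.delta)
    finally show ?thesis .
  qed
  have "(\<Sum>X'\<in>site_configs. site_matrix ?X X' * f X') = (\<Sum>X'\<in>site_configs. \<Sum>x\<in>{1..Ns}. \<Sum>y\<in>{1..Ns}. hop_amp x y *
     (of_bool ((x \<in> ?X \<and> y \<notin> ?X) \<and> X' = insert y (?X - {x})) * f X'))"
    unfolding site_matrix_def sum_distrib_right mult.assoc conj_assoc ..
  also have "\<dots> = (\<Sum>x\<in>{1..Ns}. \<Sum>y\<in>{1..Ns}. \<Sum>X'\<in>site_configs. hop_amp x y *
     (of_bool ((x \<in> ?X \<and> y \<notin> ?X) \<and> X' = insert y (?X - {x})) * f X'))"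
    by (simp only: sum.swap[of _ _ site_configs])
  also have "\<dots> = (\<Sum>x\<in>{1..Ns}. \<Sum>y\<in>{1..Ns}. hop_amp x y *
     (of_bool ((x \<in> ?X \<and> y \<notin> ?X) \<and> insert y (?X - {x}) \<in> site_configs) * f (insert y (?X - {x}))))"
    by (simp only: delta flip: sum_distrib_left)
  finally have W: "(\<Sum>X'\<in>site_configs. site_matrix ?X X' * f X') = \<dots>" .
  have "(\<Sum>S'\<in>spin_configs. of_real (hop_matrix S S') * ferro f g S') =
    (\<Sum>x\<in>{1..Ns}. \<Sum>y\<in>{1..Ns}. of_real (hop_amp x y) * hop_sum (ferro f g) S x y)"
    by (rule hop_matrix_apply) (simp add: ferro_def)
  then show ?thesis unfolding W hop_sum_ferro[OF S] by (simp add: sum_distrib_right mult.assoc)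
qed

lemma ups_le: "S \<in> spin_configs \<Longrightarrow> ups S \<le> Ne"
  unfolding ups_def using card_mono[OF finite_spin_config, of S "{m \<in> S. snd m}"] by (auto simp: spin_configs_iff)

lemma spin_config_with_ups:
  assumes "m \<le> Ne" shows "\<exists>S\<in>spin_configs. ups S = m"
proof -
  have "{k. k < Ne \<and> k < m} = {..<m}" using assms by auto
  then have "ups (labelled (pos base_lift) (\<lambda>k. k < m)) = m"
    using ups_labelled[OF inj_on_pos[OF lift_base], of "\<lambda>k. k < m"] by simp
  then show ?thesis using labelled_spin_config[OF lift_base] by (rule bexI)
qed

text \<open>Fully polarised configurations all have \<open>ups\<close> equal to \<open>Ne\<close>;
  connect them by \<open>hop_connected\<close> and forget the spins.\<close>

lemma site_configs_connected:
  assumes "X \<in> site_configs" "X' \<in> site_configs"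
  shows "(\<lambda>X X'. X \<in> site_configs \<and> X' \<in> site_configs \<and> 0 < site_matrix X X')\<^sup>*\<^sup>* X X'"
proof -
  have up: "(\<lambda>x. (x, True)) ` X \<in> spin_configs \<and> ups ((\<lambda>x. (x, True)) ` X) = Ne" if "X \<in> site_configs" for X
  proof -
    have "{m \<in> (\<lambda>x. (x, True)) ` X. snd m} = (\<lambda>x. (x, True)) ` X" by auto
    then show ?thesis using that
      by (simp add: spin_configs_def ups_def image_image inj_on_def card_image) (simp add: site_configs_def)
  qed
  have "hop_step\<^sup>*\<^sup>* ((\<lambda>x. (x, True)) ` X) ((\<lambda>x. (x, True)) ` X')"
    using up assms by (intro hop_connected) simp_all
  then have "(\<lambda>X X'. X \<in> site_configs \<and> X' \<in> site_configs \<and> 0 < site_matrix X X')\<^sup>*\<^sup>*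
      (fst ` (\<lambda>x. (x, True)) ` X) (fst ` (\<lambda>x. (x, True)) ` X')"
  proof (induction rule: rtranclp_induct)
    case (step S S')
    then show ?case using hop_step_pos[OF step(2)]
      by (intro rtranclp.rtrancl_into_rtrancl[OF step(3)]) (simp add: spin_configs_def)
  qed simp
  then show ?thesis by (simp add: image_image)
qed

lemma perron_site_vector:
  "\<exists>l f. (\<forall>X\<in>site_configs. 0 < f X) \<and> (\<forall>X\<in>site_configs. (\<Sum>X'\<in>site_configs. site_matrix X X' * f X') = l * f X)"
proof (rule perron_vector_exists[OF finite_site_configs])
  show "site_configs \<noteq> {}" using pos_image_site_configs[OF lift_base] by blast
qed (use site_matrix_nonneg site_matrix_sym site_configs_connected in auto)

section \<open>Total spin of ferromagnetic states\<close>

text \<open>The spin-\<open>Ne\<close>/2 representation on functions of the number u of up spins: u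
  electrons can be flipped down and \<open>Ne\<close> - u up. The truncated \<open>u - 1\<close> at
  u = 0 has coefficient 0.\<close>

definition spin_action :: "nat \<Rightarrow> (nat \<Rightarrow> complex) \<Rightarrow> nat \<Rightarrow> complex" where
  "spin_action \<alpha> g u = (of_nat u * (pauli \<alpha> True True * g u + pauli \<alpha> True False * g (u - 1)) +
     (of_nat Ne - of_nat u) * (pauli \<alpha> False False * g u + pauli \<alpha> False True * g (u + 1))) / 2"

lemma flip_spin_config:
  assumes S: "S \<in> spin_configs" and x: "(x, \<sigma>) \<in> S"
  shows "insert (x, \<tau>) (S - {(x, \<sigma>)}) \<in> spin_configs" "fst ` insert (x, \<tau>) (S - {(x, \<sigma>)}) = fst ` S"
    "(x, \<tau>) \<notin> S - {(x, \<sigma>)}"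
proof -
  have inj: "inj_on fst S" using S by (simp add: spin_configs_def)
  have d: "fst ` (S - {(x, \<sigma>)}) = fst ` S - {x}"
    using inj_on_image_set_diff[OF inj, of S "{(x, \<sigma>)}"] x by simp
  moreover have "x \<in> fst ` S" using x by force
  ultimately show im: "fst ` insert (x, \<tau>) (S - {(x, \<sigma>)}) = fst ` S" by auto
  have "inj_on fst (insert (x, \<tau>) (S - {(x, \<sigma>)}))"
    unfolding inj_on_insert
  proof
    show "inj_on fst (S - {(x, \<sigma>)})" by (rule inj_on_diff[OF inj])
    have "fst ` (S - {(x, \<sigma>)} - {(x, \<tau>)}) \<subseteq> fst ` S - {x}" unfolding d[symmetric] by (rule image_mono) blast
    then show "fst (x, \<tau>) \<notin> fst ` (S - {(x, \<sigma>)} - {(x, \<tau>)})" by fastforce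
  qed
  then show "insert (x, \<tau>) (S - {(x, \<sigma>)}) \<in> spin_configs"
    using S im by (simp only: spin_configs_def mem_Collect_eq)
  show "(x, \<tau>) \<notin> S - {(x, \<sigma>)}"
  proof
    assume "(x, \<tau>) \<in> S - {(x, \<sigma>)}"
    then have "fst (x, \<tau>) \<in> fst ` (S - {(x, \<sigma>)})" by (rule imageI)
    then show False unfolding d by simp
  qed
qed

lemma ups_flip:
  assumes "finite S" "(x, \<sigma>) \<in> S" "(x, \<tau>) \<notin> S - {(x, \<sigma>)}"
  shows "ups (insert (x, \<tau>) (S - {(x, \<sigma>)})) = (if \<sigma> = \<tau> then ups S else if \<sigma> then ups S - 1 else ups S + 1)"
proof (cases "\<sigma> = \<tau>")
  case True
  then have "insert (x, \<tau>) (S - {(x, \<sigma>)}) = S" using assms(2) by blast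
  then show ?thesis using True by simp
next
  case False
  let ?U = "{m \<in> S. snd m}"
  have fin: "finite ?U" using assms(1) by simp
  show ?thesis
  proof (cases \<sigma>)
    case True
    then have "{m \<in> insert (x, \<tau>) (S - {(x, \<sigma>)}). snd m} = ?U - {(x, \<sigma>)}" using False by auto
    moreover have "(x, \<sigma>) \<in> ?U" using assms(2) True by simp
    ultimately have "ups (insert (x, \<tau>) (S - {(x, \<sigma>)})) = ups S - 1"
      unfolding ups_def by (simp only: card_Diff_singleton)
    then show ?thesis using True False by simp
  next
    case down: False
    then have "{m \<in> insert (x, \<tau>) (S - {(x, \<sigma>)}). snd m} = insert (x, \<tau>) ?U" using False by auto
    moreover have "(x, \<tau>) \<notin> ?U" using assms(3) False by blast
    ultimately have "ups (insert (x, \<tau>) (S - {(x, \<sigma>)})) = Suc (ups S)"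
      unfolding ups_def using fin by (simp only: card_insert_disjoint not_False_eq_True)
    then show ?thesis using down False by simp
  qed
qed

text \<open>A spin flip leaves the occupied sites, hence \<open>f\<close>, unchanged and shifts
  \<open>ups\<close> by one; it remains to count the up and down electrons.\<close>

lemma S_tot_ferro: "S_tot Ns \<alpha> (ferro f g) = ferro f (spin_action \<alpha> g)"
proof
  fix S
  show "S_tot Ns \<alpha> (ferro f g) S = ferro f (spin_action \<alpha> g) S"
  proof (cases "S \<in> spin_configs")
    case False
    have "cre (x, \<sigma>) (ann (x, \<tau>) (ferro f g)) S = 0" for x \<sigma> \<tau>
    proof (cases "(x, \<sigma>) \<in> S \<and> (x, \<tau>) \<notin> S - {(x, \<sigma>)}")
      case True
      let ?T = "insert (x, \<tau>) (S - {(x, \<sigma>)})"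
      \<comment> \<open>Undoing the flip: if the flipped set were a spin configuration,
        \<open>S\<close> would be one.\<close>
      have "insert (x, \<sigma>) (?T - {(x, \<tau>)}) = S" using True by blast
      then have "?T \<notin> spin_configs" using flip_spin_config(1)[of ?T x \<tau> \<sigma>] False insertI1 by metis
      then show ?thesis by (simp only: cre_ann_flip ferro_def if_False if_cancel)
    qed (simp only: cre_ann_flip if_False)
    then show ?thesis using False by (simp add: S_tot_def ferro_def)
  next
    case True
    let ?u = "ups S" and ?f = "of_real (f (fst ` S)) :: complex"
    define h where "h \<sigma> = (if \<sigma> then pauli \<alpha> True True * g ?u + pauli \<alpha> True False * g (?u - 1)
        else pauli \<alpha> False False * g ?u + pauli \<alpha> False True * g (?u + 1))" for \<sigma>
    have fin: "finite S" by (rule finite_spin_config[OF True])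
    have flips: "(\<Sum>\<tau>\<in>UNIV. pauli \<alpha> \<sigma> \<tau> * cre (x, \<sigma>) (ann (x, \<tau>) (ferro f g)) S) =
      of_bool ((x, \<sigma>) \<in> S) * (?f * h \<sigma>)" for x \<sigma>
    proof (cases "(x, \<sigma>) \<in> S")
      case x: True
      have "cre (x, \<sigma>) (ann (x, \<tau>) (ferro f g)) S =
         ?f * g (if \<sigma> = \<tau> then ?u else if \<sigma> then ?u - 1 else ?u + 1)" for \<tau>
        unfolding cre_ann_flip using flip_spin_config[OF True x, of \<tau>] ups_flip[OF fin x, of \<tau>] x
        by (simp only: ferro_def if_True simp_thms)
      then show ?thesis using x by (cases \<sigma>) (simp_all add: UNIV_bool h_def algebra_simps)
    qed (simp add: cre_def)
    have sub: "S \<subseteq> {1..Ns} \<times> UNIV" and card: "card S = Ne" using True unfolding spin_configs_iff by blast+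
    have "(\<Sum>x\<in>{1..Ns}. \<Sum>\<sigma>\<in>UNIV. of_bool ((x, \<sigma>) \<in> S) * (?f * h \<sigma>)) =
       (\<Sum>m\<in>{1..Ns} \<times> UNIV. if m \<in> S then ?f * h (snd m) else 0)"
      unfolding sum.cartesian_product by (intro sum.cong) auto
    also have "\<dots> = (\<Sum>m\<in>S. ?f * h (snd m))"
      using sub by (simp add: sum.If_cases Int_absorb1)
    also have "\<dots> = (\<Sum>m\<in>{m\<in>S. snd m}. ?f * h True) + (\<Sum>m\<in>S - {m\<in>S. snd m}. ?f * h False)"
      using fin by (subst sum.subset_diff[of "{m\<in>S. snd m}" S]) (auto intro!: sum.cong arg_cong2[where f = "(+)"])
    also have "\<dots> = ?f * (of_nat ?u * h True + (of_nat Ne - of_nat ?u) * h False)"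
      using fin ups_le[OF True] card by (simp add: ups_def card_Diff_subset of_nat_diff algebra_simps)
    finally have "S_tot Ns \<alpha> (ferro f g) S = 1 / 2 * (?f * (of_nat ?u * h True + (of_nat Ne - of_nat ?u) * h False))"
      by (simp only: S_tot_def flips)
    then show ?thesis using True by (simp add: ferro_def spin_action_def h_def)
  qed
qed

text \<open>The Casimir identity. The terms shifting u by two cancel between the first two
  components, since i * i = -1.\<close>

lemma spin_action_sum_squares:
  "spin_action 1 (spin_action 1 g) u + spin_action 2 (spin_action 2 g) u + spin_action 3 (spin_action 3 g) u
    = of_nat Ne / 2 * (of_nat Ne / 2 + 1) * g u"
proof -
  have 1: "spin_action 1 g u = (of_nat u * g (u - 1) + (of_nat Ne - of_nat u) * g (u + 1)) / 2" for g u
    by (simp add: spin_action_def pauli_def)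
  have 2: "spin_action 2 g u = \<i> * ((of_nat Ne - of_nat u) * g (u + 1) - of_nat u * g (u - 1)) / 2" for g u
    by (simp add: spin_action_def pauli_def algebra_simps)
  have 3: "spin_action 3 g u = (2 * of_nat u - of_nat Ne) * g u / 2" for g u
    by (simp add: spin_action_def pauli_def algebra_simps)
  have ii: "\<i> * (A * (\<i> * B / 2) - C * (\<i> * D / 2)) / 2 = - (A * B - C * D) / 4" for A B C D
  proof -
    have "\<i> * (A * (\<i> * B / 2) - C * (\<i> * D / 2)) / 2 = (\<i> * \<i>) * (A * B - C * D) / 4"
      by (simp add: right_diff_distrib diff_divide_distrib del: complex_i_mult_minus i_complex_of_real i_squared) (simp add: mult.left_commute)
    then show ?thesis by simp
  qed
  have 22: "spin_action 2 (spin_action 2 g) u = - ((of_nat Ne - of_nat u) *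
      ((of_nat Ne - of_nat (u + 1)) * g (u + 1 + 1) - of_nat (u + 1) * g (u + 1 - 1))
      - of_nat u * ((of_nat Ne - of_nat (u - 1)) * g (u - 1 + 1) - of_nat (u - 1) * g (u - 1 - 1))) / 4"
    unfolding 2 by (rule ii)
  show ?thesis unfolding 1 22 3 by (cases u) (simp_all add: field_simps)
qed

lemma S_tot_sq_ferro:
  "S_tot_sq Ns (ferro f g) = cscale (complex_of_real (real Ne / 2 * (real Ne / 2 + 1))) (ferro f g)"
proof
  fix S
  have "S_tot_sq Ns (ferro f g) S = ferro f (spin_action 1 (spin_action 1 g)) S +
      ferro f (spin_action 2 (spin_action 2 g)) S + ferro f (spin_action 3 (spin_action 3 g)) S"
    by (simp add: S_tot_sq_def S_tot_ferro)
  also have "\<dots> = ferro f (\<lambda>u. spin_action 1 (spin_action 1 g) u + spin_action 2 (spin_action 2 g) u + spin_action 3 (spin_action 3 g) u) S"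
    by (simp add: ferro_def distrib_left)
  finally show "S_tot_sq Ns (ferro f g) S = cscale (complex_of_real (real Ne / 2 * (real Ne / 2 + 1))) (ferro f g) S"
    unfolding spin_action_sum_squares by (simp add: ferro_def cscale_def)
qed

lemma eigen_eq_iff:
  assumes "\<psi> \<in> restricted_space Ns Ne"
  shows "eff_H Ns Ne t t' \<psi> = cscale E \<psi> \<longleftrightarrow>
    (\<forall>S\<in>spin_configs. (\<Sum>S'\<in>spin_configs. of_real (hop_matrix S S') * \<psi> S') = - E * \<psi> S)"
proof -
  have "\<psi> S = 0" if "S \<notin> spin_configs" for S using assms that by (simp add: restricted_space_eq)
  moreover have "- a = E * b \<longleftrightarrow> a = - E * b" for a b :: complex
    by (metis minus_equation_iff mult_minus_left)
  ultimately show ?thesis unfolding eff_H_eq[OF assms] fun_eq_iff cscale_def by auto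
qed

section \<open>Ground states from the Perron vector of the site problem\<close>

context
  fixes l :: real and f :: "nat set \<Rightarrow> real"
  assumes f_pos: "X \<in> site_configs \<Longrightarrow> 0 < f X"
    and f_eig: "X \<in> site_configs \<Longrightarrow> (\<Sum>X'\<in>site_configs. site_matrix X X' * f X') = l * f X"
begin

lemma site_weight_pos: "S \<in> spin_configs \<Longrightarrow> 0 < f (fst ` S)"
  by (simp add: f_pos spin_configs_def)

lemma ferro_eigen:
  assumes "S \<in> spin_configs"
  shows "(\<Sum>S'\<in>spin_configs. of_real (hop_matrix S S') * ferro f g S') = of_real l * ferro f g S"
  unfolding hop_matrix_ferro[OF assms] using assms f_eig[of "fst ` S"]
  by (simp add: ferro_def spin_configs_def)

lemma eigenvector_gap_identity:
  assumes "\<psi> \<in> restricted_space Ns Ne" "eff_H Ns Ne t t' \<psi> = cscale E \<psi>"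
  shows "(\<Sum>S\<in>spin_configs. \<Sum>S'\<in>spin_configs. hop_matrix S S' * f (fst ` S) * f (fst ` S') *
      (cmod (\<psi> S / f (fst ` S) - \<psi> S' / f (fst ` S')))\<^sup>2) = 2 * (l + Re E) * (\<Sum>S\<in>spin_configs. (cmod (\<psi> S))\<^sup>2)"
proof -
  \<comment> \<open>The case g = 1: the Perron vector of the sites, read on spin configurations, is
    a positive eigenvector of \<open>hop_matrix\<close>.\<close>
  have 1: "(\<Sum>S'\<in>spin_configs. hop_matrix S S' * f (fst ` S')) = l * f (fst ` S)" if S: "S \<in> spin_configs" for S
  proof -
    have "complex_of_real (\<Sum>S'\<in>spin_configs. hop_matrix S S' * f (fst ` S')) = of_real (l * f (fst ` S))"
      using ferro_eigen[OF S, of "\<lambda>_. 1"] S by (simp add: ferro_def)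
    then show ?thesis by (simp only: of_real_eq_iff)
  qed
  have 2: "(\<Sum>S'\<in>spin_configs. of_real (hop_matrix S S') * \<psi> S') = - E * \<psi> S" if "S \<in> spin_configs" for S
    using assms eigen_eq_iff that by blast
  show ?thesis
    using perron_gap_identity[of spin_configs hop_matrix "\<lambda>S. f (fst ` S)", OF hop_matrix_sym site_weight_pos 1 2] by simp
qed

lemma gap_term_nonneg:
  "0 \<le> hop_matrix S S' * f (fst ` S) * f (fst ` S') * (cmod a)\<^sup>2" if "S \<in> spin_configs" "S' \<in> spin_configs"
  using that hop_matrix_nonneg site_weight_pos by (intro mult_nonneg_nonneg) (auto simp: less_imp_le)

text \<open>The gap identity equates a sum of nonnegative terms with 2 (l + Re E) times a positive
  squared norm.\<close>

lemma eigenvalue_ge: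
  assumes "is_eigenvalue Ns Ne t t' E" shows "- l \<le> Re E"
proof -
  obtain \<psi> where \<psi>: "\<psi> \<in> restricted_space Ns Ne" "\<psi> \<noteq> 0" "eff_H Ns Ne t t' \<psi> = cscale E \<psi>"
    using assms by (auto simp: is_eigenvalue_def)
  from \<psi>(2) obtain S where S: "\<psi> S \<noteq> 0" by (auto simp: fun_eq_iff)
  then have "S \<in> spin_configs" using \<psi>(1) by (auto simp: restricted_space_eq)
  then have pos: "0 < (\<Sum>S\<in>spin_configs. (cmod (\<psi> S))\<^sup>2)"
    using S finite_spin_configs by (intro sum_pos2[of _ S]) auto
  have "0 \<le> 2 * (l + Re E) * (\<Sum>S\<in>spin_configs. (cmod (\<psi> S))\<^sup>2)"
    unfolding eigenvector_gap_identity[OF \<psi>(1,3), symmetric] by (intro sum_nonneg gap_term_nonneg)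
  then show ?thesis using pos by (simp add: zero_le_mult_iff)
qed

lemma eigenspace_ferro: "eigenspace Ns Ne t t' (of_real (- l)) = range (ferro f)"
proof (intro equalityI subsetI)
  fix \<psi> assume "\<psi> \<in> range (ferro f)"
  then obtain g where g: "\<psi> = ferro f g" by blast
  have "eff_H Ns Ne t t' \<psi> = cscale (of_real (- l)) \<psi>"
    unfolding g eigen_eq_iff[OF ferro_restricted] using ferro_eigen by simp
  then show "\<psi> \<in> eigenspace Ns Ne t t' (of_real (- l))"
    unfolding eigenspace_def using ferro_restricted g by blast
next
  fix \<psi> assume "\<psi> \<in> eigenspace Ns Ne t t' (of_real (- l))"
  then have \<psi>: "\<psi> \<in> restricted_space Ns Ne" "eff_H Ns Ne t t' \<psi> = cscale (of_real (- l)) \<psi>"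
    by (auto simp: eigenspace_def)
  have zero: "(\<Sum>S\<in>spin_configs. \<Sum>S'\<in>spin_configs. hop_matrix S S' * f (fst ` S) * f (fst ` S') *
      (cmod (\<psi> S / f (fst ` S) - \<psi> S' / f (fst ` S')))\<^sup>2) = 0"
    using eigenvector_gap_identity[OF \<psi>] by simp
  \<comment> \<open>At E = -l the gap identity is a vanishing sum of nonnegative terms; on a hop the
    weight is strictly positive, so the difference is 0.\<close>
  have hop: "\<psi> S / f (fst ` S) = \<psi> S' / f (fst ` S')" if "hop_step S S'" for S S'
  proof -
    note S = hop_step_pos[OF that]
    have "(\<Sum>S'\<in>spin_configs. hop_matrix S S' * f (fst ` S) * f (fst ` S') *
      (cmod (\<psi> S / f (fst ` S) - \<psi> S' / f (fst ` S')))\<^sup>2) = 0"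
      using zero S(1) finite_spin_configs
      by (subst (asm) sum_nonneg_eq_0_iff) (auto intro!: sum_nonneg gap_term_nonneg)
    then have "hop_matrix S S' * f (fst ` S) * f (fst ` S') * (cmod (\<psi> S / f (fst ` S) - \<psi> S' / f (fst ` S')))\<^sup>2 = 0"
      using S finite_spin_configs by (subst (asm) sum_nonneg_eq_0_iff) (auto intro!: gap_term_nonneg)
    then show ?thesis using S(3) site_weight_pos[OF S(1)] site_weight_pos[OF S(2)] by simp
  qed
  have const: "\<psi> S / f (fst ` S) = \<psi> S' / f (fst ` S')"
    if "S \<in> spin_configs" "S' \<in> spin_configs" "ups S = ups S'" for S S'
    using hop_connected[OF that]
  proof (induction rule: rtranclp_induct)
    case (step T T')
    show ?case by (rule trans[OF step(3) hop[OF step(2)]])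
  qed simp
  obtain T where T: "\<And>m. m \<le> Ne \<Longrightarrow> T m \<in> spin_configs" "\<And>m. m \<le> Ne \<Longrightarrow> ups (T m) = m"
    using spin_config_with_ups by metis
  \<comment> \<open>The common ratio on each class, read off at a representative. For u above
    \<open>Ne\<close>, \<open>T u\<close> is unspecified, but by \<open>ups_le\<close> no
    configuration has that many up spins.\<close>
  define g where "g u = \<psi> (T u) / complex_of_real (f (fst ` T u))" for u
  have "\<psi> = ferro f g"
  proof
    fix S
    show "\<psi> S = ferro f g S"
    proof (cases "S \<in> spin_configs")
      case True
      have "\<psi> S / f (fst ` S) = g (ups S)" unfolding g_def
        by (rule const[OF True T(1)[OF ups_le[OF True]] T(2)[OF ups_le[OF True], symmetric]])
      then show ?thesis using True site_weight_pos[OF True] by (simp add: ferro_def field_simps)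
    next
      case False
      then show ?thesis using \<psi>(1) by (simp add: ferro_def restricted_space_eq)
    qed
  qed
  then show "\<psi> \<in> range (ferro f)" by blast
qed

text \<open>A state \<open>ferro f g\<close> is determined by \<open>g\<close> on 0 to
  \<open>Ne\<close>. The indicator functions of these values form a basis, separated by evaluation
  at one configuration per value, where \<open>f\<close> is positive.\<close>

lemma dim_range_ferro: "fock.dim (range (ferro f)) = Ne + 1"
proof -
  define e where "e m = ferro f (\<lambda>u. of_bool (u = m))" for m
  obtain T where T: "\<And>m. m \<le> Ne \<Longrightarrow> T m \<in> spin_configs" "\<And>m. m \<le> Ne \<Longrightarrow> ups (T m) = m"
    using spin_config_with_ups by metis
  have eT: "e k (T m) = (if k = m then of_real (f (fst ` T m)) else 0)" if "m \<le> Ne" for k m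
    using T that by (simp add: e_def ferro_def)
  have nz: "f (fst ` T m) \<noteq> 0" if "m \<le> Ne" for m using site_weight_pos[OF T(1)[OF that]] by simp
  have inj: "inj_on e {..Ne}"
  proof (rule inj_onI)
    fix k m assume "k \<in> {..Ne}" "m \<in> {..Ne}" "e k = e m"
    then show "k = m" using eT[of m k] eT[of m m] nz[of m] by (auto split: if_splits)
  qed
  have "fock.independent (e ` {..Ne})"
  proof
    assume "fock.dependent (e ` {..Ne})"
    then obtain c where "\<exists>v\<in>e ` {..Ne}. c v \<noteq> 0" and sum0: "(\<Sum>v\<in>e ` {..Ne}. cscale (c v) v) = 0"
      by (auto simp: fock.dependent_finite)
    then obtain m where m: "m \<le> Ne" "c (e m) \<noteq> 0" by auto
    have "0 = (\<Sum>k\<le>Ne. cscale (c (e k)) (e k)) (T m)"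
      using sum0 by (simp add: sum.reindex[OF inj])
    also have "\<dots> = (\<Sum>k\<le>Ne. if k = m then c (e k) * of_real (f (fst ` T m)) else 0)"
      unfolding sum_fun_at by (intro sum.cong) (auto simp: cscale_def eT[OF m(1)])
    also have "\<dots> = c (e m) * of_real (f (fst ` T m))" using m by simp
    finally show False using m nz by simp
  qed
  moreover have "range (ferro f) \<subseteq> fock.span (e ` {..Ne})"
  proof
    fix \<psi> assume "\<psi> \<in> range (ferro f)"
    then obtain g where g: "\<psi> = ferro f g" by blast
    have "\<psi> = (\<Sum>m\<le>Ne. cscale (g m) (e m))"
    proof
      fix S
      have "(\<Sum>m\<le>Ne. cscale (g m) (e m)) S = (\<Sum>m\<le>Ne. if m = ups S then ferro f g S else 0)"
        unfolding sum_fun_at by (intro sum.cong) (auto simp: cscale_def e_def ferro_def)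
      also have "\<dots> = \<psi> S" using ups_le[of S] by (cases "S \<in> spin_configs") (auto simp: g ferro_def)
      finally show "\<psi> S = (\<Sum>m\<le>Ne. cscale (g m) (e m)) S" by simp
    qed
    moreover have "(\<Sum>m\<le>Ne. cscale (g m) (e m)) \<in> fock.span (e ` {..Ne})"
      by (intro fock.span_sum fock.span_scale[OF fock.span_base] imageI)
    ultimately show "\<psi> \<in> fock.span (e ` {..Ne})" by simp
  qed
  moreover have "e ` {..Ne} \<subseteq> range (ferro f)" by (auto simp: e_def)
  moreover have "card (e ` {..Ne}) = Ne + 1" using card_image[OF inj] by simp
  ultimately show ?thesis by (intro fock.dim_unique)
qed

lemma ground_state_eigenvalue: "is_eigenvalue Ns Ne t t' (of_real (- l))"
proof -
  obtain S where S: "S \<in> spin_configs" using spin_config_with_ups[of 0] by auto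
  then have "ferro f (\<lambda>_. 1) S \<noteq> 0" using site_weight_pos[OF S] by (simp add: ferro_def)
  then have "ferro f (\<lambda>_. 1) \<noteq> 0" by auto
  moreover have "ferro f (\<lambda>_. 1) \<in> eigenspace Ns Ne t t' (of_real (- l))" unfolding eigenspace_ferro by blast
  ultimately show ?thesis by (auto simp: is_eigenvalue_def eigenspace_def)
qed

end

end

theorem mainTheorem11:
  fixes Ns Ne :: nat and t t' :: real
  assumes "even Ns" and "t > 0" and "t' > 0"
    and "odd Ne" and "Ne < Ns" and "Ns < 2 * Ne"
  shows "\<exists>E0::real.
     is_eigenvalue Ns Ne t t' (complex_of_real E0) \<and>
     (\<forall>E. is_eigenvalue Ns Ne t t' E \<longrightarrow> E0 \<le> Re E) \<and>
     (let Smax = real Ne / 2 in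
        vector_space.dim cscale (eigenspace Ns Ne t t' (complex_of_real E0)) = Ne + 1 \<and>
        (\<forall>\<psi>\<in>eigenspace Ns Ne t t' (complex_of_real E0).
           S_tot_sq Ns \<psi> = cscale (complex_of_real (Smax * (Smax + 1))) \<psi>))"
proof -
  interpret isolated_holes Ns Ne t t' using assms by unfold_locales
  obtain l f where pos: "\<And>X. X \<in> site_configs \<Longrightarrow> 0 < f X"
    and eig: "\<And>X. X \<in> site_configs \<Longrightarrow> (\<Sum>X'\<in>site_configs. site_matrix X X' * f X') = l * f X"
    using perron_site_vector by blast
  have es: "eigenspace Ns Ne t t' (complex_of_real (- l)) = range (ferro f)"
    by (rule eigenspace_ferro[OF pos eig])
  show ?thesis unfolding Let_def
  proof (intro exI[of _ "- l"] conjI allI impI ballI)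
    show "is_eigenvalue Ns Ne t t' (complex_of_real (- l))"
      by (rule ground_state_eigenvalue[OF pos eig])
    show "- l \<le> Re E" if "is_eigenvalue Ns Ne t t' E" for E
      by (rule eigenvalue_ge[OF pos eig that])
    show "fock.dim (eigenspace Ns Ne t t' (complex_of_real (- l))) = Ne + 1"
      unfolding es by (rule dim_range_ferro[OF pos eig])
    show "S_tot_sq Ns \<psi> = cscale (complex_of_real (real Ne / 2 * (real Ne / 2 + 1))) \<psi>"
      if "\<psi> \<in> eigenspace Ns Ne t t' (complex_of_real (- l))" for \<psi>
      using that unfolding es using S_tot_sq_ferro by blast
  qed
qed

end
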